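(* Let $C\in\operatorname{Hom}(V^{\pi_1}\otimes V^{\pi},V^{\pi}\otimes V^{\pi_2})$ be an $(\check R_1,\check R_2)$ intertwiner and let $\widehat C\in\operatorname{Hom}(V^{\pi_2}\otimes V^{\hat\pi},V^{\hat\pi}\otimes V^{\pi_3})$ be an $(\check R_2,\check R_3)$ intertwiner. Then $$\widehat C^{(23)}C^{(12)}\in \operatorname{Hom}(V^{\pi_1}\otimes V^{\pi}\otimes V^{\hat\pi},\,V^{\pi}\otimes V^{\hat\pi}\otimes V^{\pi_3})$$ is an $(\check R_1,\check R_3)$ intertwiner (for the connecting set $\hat\pi\circ\pi$ and the graded space $V^{\pi}\otimes V^{\hat\pi}$), i.e. on $V^{\pi_1}\otimes V^{\pi_1}\otimes V^{\pi}\otimes V^{\hat\pi}$ one has $$\widehat C^{(23)}C^{(12)}\widehat C^{(34)}C^{(23)}\check R_1(z)^{(12)}=\check R_3(z)^{(34)}\widehat C^{(23)}C^{(12)}\widehat C^{(34)}C^{(23)} .$$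
   Context: The ground field is $k=\mathbb C$. In a groupoid $\pi$, $\eta\circ\gamma$ means $\gamma$ followed by $\eta$; $s,t$ are source and target. A $\pi$-graded vector space of finite type is a family $V=(V_\alpha)_{\alpha\in\pi}$ of finite dimensional spaces indexed by the arrows such that for each object $a$ only finitely many arrows $\alpha$ with source or target $a$ have $V_\alpha\neq0$; $(V\otimes W)_\gamma=\bigoplus_{\beta\circ\alpha=\gamma}V_\alpha\otimes W_\beta$, and $\operatorname{End}(V\otimes V)$ consists of degree-preserving linear maps. A Yang--Baxter operator on $V$ is a meromorphic function $z\mapsto\check R(z)\in\operatorname{End}(V\otimes V)$ with $\check R(z-w)^{(23)}\check R(z)^{(12)}\check R(w)^{(23)}=\check R(w)^{(12)}\check R(z)^{(23)}\check R(z-w)^{(12)}$ and $\check R(z)\check R(-z)=\mathrm{id}$. Superscripts $(i\,i{+}1)$ mean that an operator acts on the tensor factors $i,i+1$ and as the identity on the others. For $i=1,2,3$ let $\pi_i$ be a groupoid, $V^{\pi_i}$ a $\pi_i$-graded vector space of finite type and $\check R_i(z)$ a Yang--Baxter operator on $V^{\pi_i}$. A connecting set from $\pi_1$ to $\pi_2$ is a set $\pi$ with surjective maps $s_\pi:\pi\to\mathrm{Ob}(\pi_1)$, $t_\pi:\pi\to\mathrm{Ob}(\pi_2)$; its elements are viewed as arrows from objects of $\pi_1$ to objects of $\pi_2$. Similarly $\hat\pi$ is a connecting set from $\pi_2$ to $\pi_3$. A $\pi$-graded space $V^\pi=(V^\pi_\beta)_{\beta\in\pi}$ consists of finite dimensional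 spaces, only finitely many being nonzero among those with a given source or a given target; likewise $V^{\hat\pi}$. Tensor products such as $V^{\pi_1}\otimes V^\pi$ or $V^\pi\otimes V^{\pi_2}\otimes V^{\pi_2}$ are direct sums, over composable strings of arrows, of the tensor products of the corresponding components (e.g. $V^{\pi_1}\otimes V^\pi=\bigoplus_{t(\alpha)=s_\pi(\beta)}V^{\pi_1}_\alpha\otimes V^\pi_\beta$). $\operatorname{Hom}$ between two such spaces denotes linear maps preserving the source (in $\mathrm{Ob}(\pi_1)$) and the target (e.g. in $\mathrm{Ob}(\pi_2)$) of strings. An $(\check R_1,\check R_2)$ intertwiner is a $C\in\operatorname{Hom}(V^{\pi_1}\otimes V^{\pi},V^{\pi}\otimes V^{\pi_2})$ with $$C^{(12)}C^{(23)}\check R_1(z)^{(12)}=\check R_2(z)^{(23)}C^{(12)}C^{(23)}\quad\text{on }V^{\pi_1}\otimes V^{\pi_1}\otimes V^\pi,$$ for all $z$; similarly for other pairs of Yang--Baxter operators. The composite connecting set from $\pi_1$ to $\pi_3$ is $\hat\pi\circ\pi=\{(\beta,\delta)\in\pi\times\hat\pi: t_\pi(\beta)=s_{\hat\pi}(\delta)\}$, with source $s_\pi(\beta)$, target $t_{\hat\pi}(\delta)$ and graded space $V^\pi\otimes V^{\hat\pi}$ with components $V^\pi_\beta\otimes V^{\hat\pi}_\delta$. *)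

theory Defs
  imports "HOL-Complex_Analysis.Complex_Analysis" "HOL-Library.Poly_Mapping"
begin

section \<open>Complex vector spaces and their tensor products\<close>

class complex_vector = ab_group_add +
  fixes scaleC :: "complex \<Rightarrow> 'a \<Rightarrow> 'a" (infixr \<open>*\<^sub>C\<close> 75)
  assumes scaleC_add_right: "a *\<^sub>C (x + y) = a *\<^sub>C x + a *\<^sub>C y"
    and scaleC_add_left: "(a + b) *\<^sub>C x = a *\<^sub>C x + b *\<^sub>C x"
    and scaleC_scaleC: "a *\<^sub>C (b *\<^sub>C x) = (a * b) *\<^sub>C x"
    and scaleC_one: "1 *\<^sub>C x = x"

global_interpretation cvec: vector_space "scaleC :: complex \<Rightarrow> 'a \<Rightarrow> 'a :: complex_vector"
  by unfold_locales (simp_all add: scaleC_add_right scaleC_add_left scaleC_scaleC scaleC_one)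

abbreviation clinear :: "('a::complex_vector \<Rightarrow> 'b::complex_vector) \<Rightarrow> bool"
  where "clinear \<equiv> Vector_Spaces.linear scaleC scaleC"

instantiation complex :: complex_vector
begin
definition "a *\<^sub>C (x::complex) = a * x"
instance by standard (simp_all add: scaleC_complex_def algebra_simps)
end

instantiation poly_mapping :: (type, complex_vector) complex_vector
begin
definition "a *\<^sub>C (x :: 'a \<Rightarrow>\<^sub>0 'b) = Poly_Mapping.map (scaleC a) x"

lemma lookup_scaleC: "Poly_Mapping.lookup (a *\<^sub>C (x :: 'a \<Rightarrow>\<^sub>0 'b)) i = a *\<^sub>C Poly_Mapping.lookup x i"
  by (cases "Poly_Mapping.lookup x i = 0") (simp_all add: scaleC_poly_mapping_def map.rep_eq)

instance
  by standard
    (auto intro!: poly_mapping_eqI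
       simp: lookup_scaleC lookup_add scaleC_add_right scaleC_add_left scaleC_scaleC scaleC_one)
end

text \<open>The tensor product over \<open>\<complex>\<close> is the free vector space on pairs modulo the
  bilinearity relations.\<close>

inductive_set tensor_relators :: "(('a::complex_vector \<times> 'b::complex_vector) \<Rightarrow>\<^sub>0 complex) set"
  where
    add_left: "Poly_Mapping.single (v + v', w) 1 - Poly_Mapping.single (v, w) 1
        - Poly_Mapping.single (v', w) 1 \<in> tensor_relators"
  | add_right: "Poly_Mapping.single (v, w + w') 1 - Poly_Mapping.single (v, w) 1
        - Poly_Mapping.single (v, w') 1 \<in> tensor_relators"
  | scale_left: "Poly_Mapping.single (c *\<^sub>C v, w) 1 - c *\<^sub>C Poly_Mapping.single (v, w) 1
        \<in> tensor_relators"
  | scale_right: "Poly_Mapping.single (v, c *\<^sub>C w) 1 - c *\<^sub>C Poly_Mapping.single (v, w) 1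
        \<in> tensor_relators"

quotient_type (overloaded) ('a, 'b) tensor = "('a::complex_vector \<times> 'b::complex_vector) \<Rightarrow>\<^sub>0 complex"
  / "\<lambda>x y. x - y \<in> cvec.span tensor_relators"
proof (intro equivpI reflpI sympI transpI)
  fix x y z :: "('a \<times> 'b) \<Rightarrow>\<^sub>0 complex"
  show "x - x \<in> cvec.span tensor_relators"
    by (simp add: cvec.span_zero)
  show "y - x \<in> cvec.span tensor_relators" if "x - y \<in> cvec.span tensor_relators"
    using cvec.span_neg[OF that] by simp
  show "x - z \<in> cvec.span tensor_relators"
    if "x - y \<in> cvec.span tensor_relators" "y - z \<in> cvec.span tensor_relators"
    using cvec.span_add[OF that] by simp
qed

instantiation tensor :: (complex_vector, complex_vector) complex_vector
begin
lift_definition zero_tensor :: "('a, 'b) tensor" is 0 .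
lift_definition plus_tensor :: "('a, 'b) tensor \<Rightarrow> ('a, 'b) tensor \<Rightarrow> ('a, 'b) tensor" is "(+)"
  using cvec.span_add by (fastforce simp: algebra_simps)
lift_definition minus_tensor :: "('a, 'b) tensor \<Rightarrow> ('a, 'b) tensor \<Rightarrow> ('a, 'b) tensor" is "(-)"
  using cvec.span_diff by (fastforce simp: algebra_simps)
lift_definition uminus_tensor :: "('a, 'b) tensor \<Rightarrow> ('a, 'b) tensor" is uminus
  using cvec.span_neg by (fastforce simp: algebra_simps)
lift_definition scaleC_tensor :: "complex \<Rightarrow> ('a, 'b) tensor \<Rightarrow> ('a, 'b) tensor" is scaleC
  by (metis cvec.scale_right_diff_distrib cvec.span_scale)
instance
  by standard
    (transfer, simp add: cvec.span_zero algebra_simps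
       scaleC_add_right scaleC_add_left scaleC_scaleC scaleC_one)+
end

lift_definition tens :: "'a::complex_vector \<Rightarrow> 'b::complex_vector \<Rightarrow> ('a, 'b) tensor"
  is "\<lambda>v w. Poly_Mapping.single (v, w) 1" .


section \<open>Graded spaces\<close>

text \<open>A set of arrows, possibly between two different sets of objects.\<close>

record ('i, 'o, 'p) arrows =
  arr :: "'i set"
  src :: "'i \<Rightarrow> 'o"
  tgt :: "'i \<Rightarrow> 'p"

record ('a, 'o) groupoid = "('a, 'o, 'o) arrows" +
  obj :: "'o set"
  cmp :: "'a \<Rightarrow> 'a \<Rightarrow> 'a"
  idt :: "'o \<Rightarrow> 'a"

text \<open>\<open>cmp G \<eta> \<gamma>\<close> is \<open>\<gamma>\<close> followed by \<open>\<eta>\<close>.\<close>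

definition is_groupoid :: "('a, 'o) groupoid \<Rightarrow> bool" where
  "is_groupoid G \<longleftrightarrow>
     (\<forall>\<alpha>\<in>arr G. src G \<alpha> \<in> obj G \<and> tgt G \<alpha> \<in> obj G) \<and>
     (\<forall>\<gamma>\<in>arr G. \<forall>\<eta>\<in>arr G. tgt G \<gamma> = src G \<eta> \<longrightarrow>
        cmp G \<eta> \<gamma> \<in> arr G \<and> src G (cmp G \<eta> \<gamma>) = src G \<gamma> \<and> tgt G (cmp G \<eta> \<gamma>) = tgt G \<eta>) \<and>
     (\<forall>\<gamma>\<in>arr G. \<forall>\<eta>\<in>arr G. \<forall>\<theta>\<in>arr G. tgt G \<gamma> = src G \<eta> \<longrightarrow> tgt G \<eta> = src G \<theta> \<longrightarrow>
        cmp G \<theta> (cmp G \<eta> \<gamma>) = cmp G (cmp G \<theta> \<eta>) \<gamma>) \<and>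
     (\<forall>a\<in>obj G. idt G a \<in> arr G \<and> src G (idt G a) = a \<and> tgt G (idt G a) = a) \<and>
     (\<forall>\<gamma>\<in>arr G. cmp G \<gamma> (idt G (src G \<gamma>)) = \<gamma> \<and> cmp G (idt G (tgt G \<gamma>)) \<gamma> = \<gamma>) \<and>
     (\<forall>\<gamma>\<in>arr G. \<exists>\<eta>\<in>arr G. src G \<eta> = tgt G \<gamma> \<and> tgt G \<eta> = src G \<gamma> \<and>
        cmp G \<eta> \<gamma> = idt G (src G \<gamma>) \<and> cmp G \<gamma> \<eta> = idt G (tgt G \<gamma>))"

definition connecting_set ::
  "('a, 'o) groupoid \<Rightarrow> ('b, 'p) groupoid \<Rightarrow> ('i, 'o, 'p) arrows \<Rightarrow> bool" where
  "connecting_set G H P \<longleftrightarrow> src P ` arr P = obj G \<and> tgt P ` arr P = obj H"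

text \<open>A family of vector spaces is a family of subspaces of one ambient vector space \<open>'v\<close>
  (for instance of the direct sum of the family).\<close>

definition finite_type ::
  "('i, 'o, 'p, 'z) arrows_scheme \<Rightarrow> ('i \<Rightarrow> 'v::complex_vector set) \<Rightarrow> bool" where
  "finite_type S V \<longleftrightarrow>
     (\<forall>i\<in>arr S. \<exists>B. finite B \<and> V i = cvec.span B) \<and>
     (\<forall>a. finite {i\<in>arr S. src S i = a \<and> V i \<noteq> {0}}) \<and>
     (\<forall>b. finite {i\<in>arr S. tgt S i = b \<and> V i \<noteq> {0}})"

record ('i, 'o, 'p, 'v) gspace = "('i, 'o, 'p) arrows" +
  fib :: "'i \<Rightarrow> 'v set"

definition gr :: "('i, 'o, 'p, 'z) arrows_scheme \<Rightarrow> ('i \<Rightarrow> 'v set) \<Rightarrow> ('i, 'o, 'p, 'v) gspace"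
  where "gr S V = \<lparr>arr = arr S, src = src S, tgt = tgt S, fib = V\<rparr>"

text \<open>The direct sum of the components, realised as finitely supported families.\<close>

definition total_space :: "('i, 'o, 'p, 'v::complex_vector) gspace \<Rightarrow> ('i \<Rightarrow>\<^sub>0 'v) set" where
  "total_space X = {x. \<forall>i\<in>Poly_Mapping.keys x. i \<in> arr X \<and> Poly_Mapping.lookup x i \<in> fib X i}"

definition linear_on :: "'a::complex_vector set \<Rightarrow> ('a \<Rightarrow> 'b::complex_vector) \<Rightarrow> bool" where
  "linear_on S f \<longleftrightarrow>
     (\<forall>x\<in>S. \<forall>y\<in>S. f (x + y) = f x + f y) \<and> (\<forall>c. \<forall>x\<in>S. f (c *\<^sub>C x) = c *\<^sub>C f x)"

text \<open>Linear maps preserving source and target. Such a map is a HOL function whose values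
  outside \<open>total_space X\<close> are irrelevant.\<close>

definition Hom :: "('i, 'o, 'p, 'v::complex_vector) gspace \<Rightarrow> ('k, 'o, 'p, 'w::complex_vector) gspace
    \<Rightarrow> (('i \<Rightarrow>\<^sub>0 'v) \<Rightarrow> ('k \<Rightarrow>\<^sub>0 'w)) set" where
  "Hom X Y = {f. linear_on (total_space X) f \<and> f ` total_space X \<subseteq> total_space Y \<and>
     (\<forall>a b. \<forall>x\<in>total_space X. (\<forall>i\<in>Poly_Mapping.keys x. src X i = a \<and> tgt X i = b) \<longrightarrow>
        (\<forall>k\<in>Poly_Mapping.keys (f x). src Y k = a \<and> tgt Y k = b))}"


section \<open>Tensor products of graded spaces\<close>

definition comp_arrows ::
  "('i, 'o, 'p, 'y) arrows_scheme \<Rightarrow> ('j, 'p, 'q, 'z) arrows_scheme \<Rightarrow> ('i \<times> 'j, 'o, 'q) arrows"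
  where "comp_arrows S T =
    \<lparr>arr = {(i, j). i \<in> arr S \<and> j \<in> arr T \<and> tgt S i = src T j},
     src = (\<lambda>(i, j). src S i), tgt = (\<lambda>(i, j). tgt T j)\<rparr>"

definition tensor_fib :: "('i \<Rightarrow> 'v::complex_vector set) \<Rightarrow> ('j \<Rightarrow> 'w::complex_vector set)
    \<Rightarrow> 'i \<times> 'j \<Rightarrow> ('v, 'w) tensor set" where
  "tensor_fib V W = (\<lambda>(i, j). cvec.span {tens v w | v w. v \<in> V i \<and> w \<in> W j})"

definition gtensor :: "('i, 'o, 'p, 'v::complex_vector) gspace \<Rightarrow> ('j, 'p, 'q, 'w::complex_vector) gspace
    \<Rightarrow> ('i \<times> 'j, 'o, 'q, ('v, 'w) tensor) gspace" (infixr \<open>\<otimes>\<^sub>g\<close> 70)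
  where "X \<otimes>\<^sub>g Y = gr (comp_arrows X Y) (tensor_fib (fib X) (fib Y))"

text \<open>The product of two elements of the total spaces; the terms belonging to
  non-composable strings vanish.\<close>

definition gtens :: "('i, 'o, 'p, 'v::complex_vector) gspace \<Rightarrow> ('j, 'p, 'q, 'w::complex_vector) gspace
    \<Rightarrow> ('i \<Rightarrow>\<^sub>0 'v) \<Rightarrow> ('j \<Rightarrow>\<^sub>0 'w) \<Rightarrow> ('i \<times> 'j \<Rightarrow>\<^sub>0 ('v, 'w) tensor)" where
  "gtens X Y x y = (\<Sum>i\<in>Poly_Mapping.keys x. \<Sum>j\<in>Poly_Mapping.keys y.
     if tgt X i = src Y j then Poly_Mapping.single (i, j) (tens (Poly_Mapping.lookup x i) (Poly_Mapping.lookup y j)) else 0)"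

text \<open>The linear maps \<open>f \<otimes> g\<close>, \<open>(x \<otimes> y) \<otimes> z \<mapsto> x \<otimes> (y \<otimes> z)\<close> and
  \<open>x \<otimes> (y \<otimes> z) \<mapsto> (x \<otimes> y) \<otimes> z\<close>; lemmas \<open>map_gtensor\<close>, \<open>assoc_r\<close> and \<open>assoc_l\<close> below show that
  the descriptions are proper.\<close>

definition is_map_gtensor ::
  "('i, 'o, 'p, 'v::complex_vector) gspace \<Rightarrow> ('j, 'p, 'q, 'w::complex_vector) gspace
    \<Rightarrow> ('k, 'o, 'p, 'v2::complex_vector) gspace \<Rightarrow> ('l, 'p, 'q, 'w2::complex_vector) gspace
    \<Rightarrow> (('i \<Rightarrow>\<^sub>0 'v) \<Rightarrow> ('k \<Rightarrow>\<^sub>0 'v2)) \<Rightarrow> (('j \<Rightarrow>\<^sub>0 'w) \<Rightarrow> ('l \<Rightarrow>\<^sub>0 'w2))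
    \<Rightarrow> (('i \<times> 'j \<Rightarrow>\<^sub>0 ('v, 'w) tensor) \<Rightarrow> ('k \<times> 'l \<Rightarrow>\<^sub>0 ('v2, 'w2) tensor)) \<Rightarrow> bool" where
  "is_map_gtensor X Y X' Y' f g h \<longleftrightarrow> linear_on (total_space (X \<otimes>\<^sub>g Y)) h \<and>
     (\<forall>x\<in>total_space X. \<forall>y\<in>total_space Y. h (gtens X Y x y) = gtens X' Y' (f x) (g y)) \<and>
     (\<forall>t. t \<notin> total_space (X \<otimes>\<^sub>g Y) \<longrightarrow> h t = 0)"

definition map_gtensor where
  "map_gtensor X Y X' Y' f g = (THE h. is_map_gtensor X Y X' Y' f g h)"

definition is_assoc_r where
  "is_assoc_r X Y Z h \<longleftrightarrow> linear_on (total_space ((X \<otimes>\<^sub>g Y) \<otimes>\<^sub>g Z)) h \<and>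
     (\<forall>x\<in>total_space X. \<forall>y\<in>total_space Y. \<forall>z\<in>total_space Z.
        h (gtens (X \<otimes>\<^sub>g Y) Z (gtens X Y x y) z) = gtens X (Y \<otimes>\<^sub>g Z) x (gtens Y Z y z)) \<and>
     (\<forall>t. t \<notin> total_space ((X \<otimes>\<^sub>g Y) \<otimes>\<^sub>g Z) \<longrightarrow> h t = 0)"

definition assoc_r where
  "assoc_r X Y Z = (THE h. is_assoc_r X Y Z h)"

definition is_assoc_l where
  "is_assoc_l X Y Z h \<longleftrightarrow> linear_on (total_space (X \<otimes>\<^sub>g (Y \<otimes>\<^sub>g Z))) h \<and>
     (\<forall>x\<in>total_space X. \<forall>y\<in>total_space Y. \<forall>z\<in>total_space Z.
        h (gtens X (Y \<otimes>\<^sub>g Z) x (gtens Y Z y z)) = gtens (X \<otimes>\<^sub>g Y) Z (gtens X Y x y) z) \<and>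
     (\<forall>t. t \<notin> total_space (X \<otimes>\<^sub>g (Y \<otimes>\<^sub>g Z)) \<longrightarrow> h t = 0)"

definition assoc_l where
  "assoc_l X Y Z = (THE h. is_assoc_l X Y Z h)"

text \<open>Multiple tensor products are bracketed to the right. For \<open>f : Y \<rightarrow> Y'\<close>, \<open>tail X Y Y' f\<close> is
  \<open>id \<otimes> f : X \<otimes> Y \<rightarrow> X \<otimes> Y'\<close>. For \<open>f : X \<otimes> Y \<rightarrow> X' \<otimes> Y'\<close>, \<open>head X Y X' Y' Z f\<close> is \<open>f\<close> acting on the
  first two factors, \<open>X \<otimes> Y \<otimes> Z \<rightarrow> X' \<otimes> Y' \<otimes> Z\<close>. So the superscript (12) is \<open>head\<close>, the last pair of factors
  is an iterated \<open>tail\<close>, and (23) on four factors is the \<open>tail\<close> of a \<open>head\<close>.\<close>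

definition tail where
  "tail X Y Y' f = map_gtensor X Y X Y' id f"

definition head where
  "head X Y X' Y' Z f = assoc_r X' Y' Z \<circ> map_gtensor (X \<otimes>\<^sub>g Y) Z (X' \<otimes>\<^sub>g Y') Z f id \<circ> assoc_l X Y Z"


section \<open>Yang--Baxter operators and intertwiners\<close>

text \<open>Degree-preserving endomorphisms of \<open>V \<otimes> V\<close>, a string \<open>(\<alpha>, \<beta>)\<close> having degree \<open>\<beta> \<circ> \<alpha>\<close>.\<close>

definition End2 :: "('a, 'o) groupoid \<Rightarrow> ('a \<Rightarrow> 'v::complex_vector set)
    \<Rightarrow> (('a \<times> 'a \<Rightarrow>\<^sub>0 ('v, 'v) tensor) \<Rightarrow> ('a \<times> 'a \<Rightarrow>\<^sub>0 ('v, 'v) tensor)) set" where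
  "End2 G V = {f. linear_on (total_space (gr G V \<otimes>\<^sub>g gr G V)) f \<and>
     f ` total_space (gr G V \<otimes>\<^sub>g gr G V) \<subseteq> total_space (gr G V \<otimes>\<^sub>g gr G V) \<and>
     (\<forall>\<gamma>. \<forall>x\<in>total_space (gr G V \<otimes>\<^sub>g gr G V). (\<forall>(\<alpha>, \<beta>)\<in>Poly_Mapping.keys x. cmp G \<beta> \<alpha> = \<gamma>) \<longrightarrow>
        (\<forall>(\<alpha>, \<beta>)\<in>Poly_Mapping.keys (f x). cmp G \<beta> \<alpha> = \<gamma>))}"

text \<open>As usual for \<^const>\<open>meromorphic_on\<close>, a meromorphic operator-valued function is a total function
  with arbitrary values at its poles (here they are chosen in \<open>End(V \<otimes> V)\<close>), and meromorphic
  functions are identified if they agree off a discrete closed set, which is the meaning of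
  \<open>\<forall>\<^sub>\<approx>z\<close>. The space \<open>End(V \<otimes> V)\<close> is a product of finite dimensional spaces, so meromorphy and
  equality are componentwise. Hence the exceptional sets below may depend on \<open>x\<close>.
  For meromorphic functions of \<open>(z, w)\<close>, the iterated \<open>\<forall>\<^sub>\<approx>w. \<forall>\<^sub>\<approx>z\<close> is equality off the poles, by
  analytic continuation.\<close>

definition yang_baxter :: "('a, 'o) groupoid \<Rightarrow> ('a \<Rightarrow> 'v::complex_vector set)
    \<Rightarrow> (complex \<Rightarrow> ('a \<times> 'a \<Rightarrow>\<^sub>0 ('v, 'v) tensor) \<Rightarrow> ('a \<times> 'a \<Rightarrow>\<^sub>0 ('v, 'v) tensor)) \<Rightarrow> bool" where
  "yang_baxter G V R \<longleftrightarrow>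
     (let X = gr G V;
          R12 = (\<lambda>z. head X X X X X (R z));
          R23 = (\<lambda>z. tail X (X \<otimes>\<^sub>g X) (X \<otimes>\<^sub>g X) (R z))
      in (\<forall>z. R z \<in> End2 G V) \<and>
         (\<forall>x\<in>total_space (X \<otimes>\<^sub>g X). \<forall>\<phi> :: _ \<Rightarrow> complex. clinear \<phi> \<longrightarrow>
            (\<lambda>z. \<phi> (R z x)) meromorphic_on UNIV) \<and>
         (\<forall>x\<in>total_space (X \<otimes>\<^sub>g X \<otimes>\<^sub>g X). \<forall>\<^sub>\<approx>w. \<forall>\<^sub>\<approx>z.
            R23 (z - w) (R12 z (R23 w x)) = R12 w (R23 z (R12 (z - w) x))) \<and>
         (\<forall>x\<in>total_space (X \<otimes>\<^sub>g X). \<forall>\<^sub>\<approx>z. R z (R (- z) x) = x))"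

text \<open>\<open>intertwiner G V R H W S P U C\<close>: \<open>C\<close> is an \<open>(R, S)\<close> intertwiner, for the Yang--Baxter operators
  \<open>R\<close> on the \<open>G\<close>-graded \<open>V\<close> and \<open>S\<close> on the \<open>H\<close>-graded \<open>W\<close>, the connecting set \<open>P\<close> and the
  \<open>P\<close>-graded \<open>U\<close>.\<close>

definition intertwiner ::
  "('a, 'o) groupoid \<Rightarrow> ('a \<Rightarrow> 'v::complex_vector set)
    \<Rightarrow> (complex \<Rightarrow> ('a \<times> 'a \<Rightarrow>\<^sub>0 ('v, 'v) tensor) \<Rightarrow> ('a \<times> 'a \<Rightarrow>\<^sub>0 ('v, 'v) tensor))
    \<Rightarrow> ('b, 'p) groupoid \<Rightarrow> ('b \<Rightarrow> 'w::complex_vector set)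
    \<Rightarrow> (complex \<Rightarrow> ('b \<times> 'b \<Rightarrow>\<^sub>0 ('w, 'w) tensor) \<Rightarrow> ('b \<times> 'b \<Rightarrow>\<^sub>0 ('w, 'w) tensor))
    \<Rightarrow> ('i, 'o, 'p) arrows \<Rightarrow> ('i \<Rightarrow> 'u::complex_vector set)
    \<Rightarrow> (('a \<times> 'i \<Rightarrow>\<^sub>0 ('v, 'u) tensor) \<Rightarrow> ('i \<times> 'b \<Rightarrow>\<^sub>0 ('u, 'w) tensor)) \<Rightarrow> bool" where
  "intertwiner G V R H W S P U C \<longleftrightarrow>
     (let X = gr G V; Y = gr H W; M = gr P U;
          R12 = (\<lambda>z. head X X X X M (R z));
          S23 = (\<lambda>z. tail M (Y \<otimes>\<^sub>g Y) (Y \<otimes>\<^sub>g Y) (S z));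
          C23 = tail X (X \<otimes>\<^sub>g M) (M \<otimes>\<^sub>g Y) C;
          C12 = head X M M Y Y C
      in C \<in> Hom (X \<otimes>\<^sub>g M) (M \<otimes>\<^sub>g Y) \<and>
         (\<forall>x\<in>total_space (X \<otimes>\<^sub>g X \<otimes>\<^sub>g M). \<forall>\<^sub>\<approx>z. C12 (C23 (R12 z x)) = S23 z (C12 (C23 x))))"


section \<open>Well-definedness of the canonical maps\<close>

lemma clinear_iff: "clinear f \<longleftrightarrow> (\<forall>x y. f (x + y) = f x + f y) \<and> (\<forall>c x. f (c *\<^sub>C x) = c *\<^sub>C f x)"
  by (auto simp: Vector_Spaces.linear_iff cvec.vector_space_axioms)

lemma clinear_add: "clinear f \<Longrightarrow> f (x + y) = f x + f y"
  and clinear_scale: "clinear f \<Longrightarrow> f (c *\<^sub>C x) = c *\<^sub>C f x"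
  by (simp_all add: clinear_iff)

lemma clinear_0: "clinear f \<Longrightarrow> f 0 = 0"
  by (metis add_cancel_right_left clinear_add)

lemma clinear_diff: "clinear f \<Longrightarrow> f (x - y) = f x - f y"
  by (metis add_diff_cancel clinear_add diff_add_cancel)

lemma clinear_sum: "clinear f \<Longrightarrow> f (sum g A) = (\<Sum>i\<in>A. f (g i))"
  by (induction A rule: infinite_finite_induct) (auto simp: clinear_0 clinear_add)

definition cbilinear ::
  "('a::complex_vector \<Rightarrow> 'b::complex_vector \<Rightarrow> 'c::complex_vector) \<Rightarrow> bool" where
  "cbilinear b \<longleftrightarrow> (\<forall>v. clinear (b v)) \<and> (\<forall>w. clinear (\<lambda>v. b v w))"

lemma cbilinearD:
  assumes "cbilinear b"
  shows "b (v + v') w = b v w + b v' w" "b v (w + w') = b v w + b v w'"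
    "b (c *\<^sub>C v) w = c *\<^sub>C b v w" "b v (c *\<^sub>C w) = c *\<^sub>C b v w" "b 0 w = 0" "b v 0 = 0"
proof -
  have l: "clinear (b v)" for v
    using assms by (simp add: cbilinear_def)
  have r: "clinear (\<lambda>v. b v w)" for w
    using assms by (simp add: cbilinear_def)
  show "b (v + v') w = b v w + b v' w" "b (c *\<^sub>C v) w = c *\<^sub>C b v w" "b 0 w = 0"
    by (fact clinear_add[OF r] clinear_scale[OF r] clinear_0[OF r])+
  show "b v (w + w') = b v w + b v w'" "b v (c *\<^sub>C w) = c *\<^sub>C b v w" "b v 0 = 0"
    by (fact clinear_add[OF l] clinear_scale[OF l] clinear_0[OF l])+
qed

lemma cbilinear_tens: "cbilinear tens"
  unfolding cbilinear_def clinear_iff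
proof (intro conjI allI)
  fix v v' w w' c
  show "tens v (w + w') = tens v w + tens v w'"
    using cvec.span_base[OF tensor_relators.add_right]
    by (simp add: tens.abs_eq plus_tensor.abs_eq scaleC_tensor.abs_eq tensor.abs_eq_iff
        cvec.span_zero diff_diff_eq)
  show "tens (v + v') w = tens v w + tens v' w"
    using cvec.span_base[OF tensor_relators.add_left]
    by (simp add: tens.abs_eq plus_tensor.abs_eq scaleC_tensor.abs_eq tensor.abs_eq_iff
        cvec.span_zero diff_diff_eq)
  show "tens v (c *\<^sub>C w) = c *\<^sub>C tens v w"
    using cvec.span_base[OF tensor_relators.scale_right]
    by (simp add: tens.abs_eq plus_tensor.abs_eq scaleC_tensor.abs_eq tensor.abs_eq_iff
        cvec.span_zero diff_diff_eq)
  show "tens (c *\<^sub>C v) w = c *\<^sub>C tens v w"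
    using cvec.span_base[OF tensor_relators.scale_left]
    by (simp add: tens.abs_eq plus_tensor.abs_eq scaleC_tensor.abs_eq tensor.abs_eq_iff
        cvec.span_zero diff_diff_eq)
qed

lemmas tens_simps = cbilinearD[OF cbilinear_tens]

definition free_ext :: "('k \<Rightarrow> 'c::complex_vector) \<Rightarrow> ('k \<Rightarrow>\<^sub>0 complex) \<Rightarrow> 'c" where
  "free_ext b p = (\<Sum>k\<in>Poly_Mapping.keys p. Poly_Mapping.lookup p k *\<^sub>C b k)"

text \<open>Sums over the support of a linear expression in the values are linear.\<close>

lemma clinear_sum_keys:
  fixes L :: "'k \<Rightarrow> 'a::complex_vector \<Rightarrow> 'c::complex_vector"
  assumes L: "\<And>k. clinear (L k)"
  shows "clinear (\<lambda>p. \<Sum>k\<in>Poly_Mapping.keys p. L k (Poly_Mapping.lookup p k))"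
proof -
  have *: "(\<Sum>k\<in>Poly_Mapping.keys p. L k (Poly_Mapping.lookup p k)) =
      (\<Sum>k\<in>A. L k (Poly_Mapping.lookup p k))"
    if "finite A" "Poly_Mapping.keys p \<subseteq> A" for p :: "'k \<Rightarrow>\<^sub>0 'a" and A
    using that by (intro sum.mono_neutral_left) (auto simp: in_keys_iff clinear_0[OF L])
  show ?thesis
    unfolding clinear_iff
  proof (intro conjI allI)
    fix p q :: "'k \<Rightarrow>\<^sub>0 'a" and c
    let ?A = "Poly_Mapping.keys p \<union> Poly_Mapping.keys q"
    show "(\<Sum>k\<in>Poly_Mapping.keys (p + q). L k (Poly_Mapping.lookup (p + q) k)) =
      (\<Sum>k\<in>Poly_Mapping.keys p. L k (Poly_Mapping.lookup p k)) +
      (\<Sum>k\<in>Poly_Mapping.keys q. L k (Poly_Mapping.lookup q k))"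
      using Poly_Mapping.keys_add[of p q]
      by (subst (1 2 3) *[of ?A]) (auto simp: lookup_add clinear_add[OF L] sum.distrib)
    have "Poly_Mapping.keys (c *\<^sub>C p) \<subseteq> Poly_Mapping.keys p"
      by (auto simp: in_keys_iff lookup_scaleC)
    then show "(\<Sum>k\<in>Poly_Mapping.keys (c *\<^sub>C p). L k (Poly_Mapping.lookup (c *\<^sub>C p) k)) =
      c *\<^sub>C (\<Sum>k\<in>Poly_Mapping.keys p. L k (Poly_Mapping.lookup p k))"
      by (subst *[of "Poly_Mapping.keys p" "c *\<^sub>C p"])
        (auto simp: lookup_scaleC clinear_scale[OF L] cvec.scale_sum_right)
  qed
qed

lemma clinear_free_ext: "clinear (free_ext b)"
  unfolding free_ext_def
  by (rule clinear_sum_keys) (simp add: clinear_iff scaleC_add_left scaleC_complex_def scaleC_scaleC)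

lemma free_ext_single [simp]: "free_ext b (Poly_Mapping.single k 1) = b k"
  by (simp add: free_ext_def)

text \<open>The universal property.\<close>

lemma tensor_lift:
  assumes b: "cbilinear b"
  obtains L where "clinear L" "\<And>v w. L (tens v w) = b v w"
proof -
  define F where "F = free_ext (\<lambda>(v, w). b v w)"
  have F: "clinear F"
    unfolding F_def by (rule clinear_free_ext)
  have Fs: "F (Poly_Mapping.single (v, w) 1) = b v w" for v w
    by (simp add: F_def)
  have rel: "F p = 0" if "p \<in> tensor_relators" for p
    using that
    by cases (simp_all add: clinear_diff[OF F] clinear_scale[OF F] Fs cbilinearD[OF b])
  have "F p = 0" if "p \<in> cvec.span tensor_relators" for p
    using that
    by (induction rule: cvec.span_induct_alt)
      (simp_all add: clinear_0[OF F] clinear_add[OF F] clinear_scale[OF F] rel)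
  then have resp: "F p = F q" if "p - q \<in> cvec.span tensor_relators" for p q
    using that clinear_diff[OF F, of p q] by (metis eq_iff_diff_eq_0)
  define L where "L t = F (rep_tensor t)" for t
  have L: "L (abs_tensor p) = F p" for p
    unfolding L_def
    by (rule resp) (use Quotient3_rep_abs[OF Quotient3_tensor, of p] in \<open>simp add: cvec.span_zero\<close>)
  have "clinear L"
    unfolding clinear_iff
  proof (intro conjI allI)
    fix s t :: "('a, 'b) tensor" and c
    obtain p q where "s = abs_tensor p" "t = abs_tensor q"
      using Quotient3_abs_rep[OF Quotient3_tensor] by metis
    then show "L (s + t) = L s + L t" "L (c *\<^sub>C s) = c *\<^sub>C L s"
      by (simp_all add: plus_tensor.abs_eq scaleC_tensor.abs_eq L clinear_add[OF F]
          clinear_scale[OF F] cvec.span_zero)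
  qed
  moreover have "L (tens v w) = b v w" for v w
    by (simp add: tens.abs_eq L Fs)
  ultimately show thesis
    using that by blast
qed

lemma tensor_lift_ex:
  "cbilinear b \<Longrightarrow> \<exists>L. clinear L \<and> (\<forall>v w. L (tens v w) = b v w)"
  using tensor_lift by blast

lemma poly_mapping_eq_sum_single:
  "p = (\<Sum>k\<in>Poly_Mapping.keys p. Poly_Mapping.single k (Poly_Mapping.lookup p k))"
  by (rule poly_mapping_eqI) (auto simp: lookup_sum lookup_single when_def in_keys_iff)

lemma tensor_span: "t \<in> cvec.span {tens v w | v w. True}"
proof -
  have A: "clinear (abs_tensor :: (('a \<times> 'b) \<Rightarrow>\<^sub>0 complex) \<Rightarrow> _)"
    by (simp add: clinear_iff plus_tensor.abs_eq scaleC_tensor.abs_eq cvec.span_zero)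
  obtain p where p: "t = abs_tensor p"
    using Quotient3_abs_rep[OF Quotient3_tensor] by metis
  have *: "Poly_Mapping.single k c = c *\<^sub>C Poly_Mapping.single k (1::complex)" for k :: "'a \<times> 'b" and c
    by (rule poly_mapping_eqI) (simp add: lookup_scaleC lookup_single when_def scaleC_complex_def)
  have "t = (\<Sum>k\<in>Poly_Mapping.keys p. abs_tensor (Poly_Mapping.single k (Poly_Mapping.lookup p k)))"
    unfolding p by (subst poly_mapping_eq_sum_single) (rule clinear_sum[OF A])
  also have "\<dots> = (\<Sum>k\<in>Poly_Mapping.keys p. Poly_Mapping.lookup p k *\<^sub>C tens (fst k) (snd k))"
    by (subst *) (simp add: clinear_scale[OF A] tens.abs_eq)
  also have "\<dots> \<in> cvec.span {tens v w | v w. True}"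
    by (intro cvec.span_sum cvec.span_scale cvec.span_base) blast
  finally show ?thesis .
qed

lemma clinear_eq_on_span:
  assumes "clinear f" "clinear g" "\<And>x. x \<in> S \<Longrightarrow> f x = g x" "x \<in> cvec.span S"
  shows "f x = g x"
  using assms(4)
  by (induction rule: cvec.span_induct_alt)
    (simp_all add: assms(3) clinear_0[OF assms(1)] clinear_0[OF assms(2)]
      clinear_add[OF assms(1)] clinear_add[OF assms(2)]
      clinear_scale[OF assms(1)] clinear_scale[OF assms(2)])

lemma tensor_eqI:
  assumes "clinear f" "clinear g" "\<And>v w. f (tens v w) = g (tens v w)"
  shows "f = g"
  using clinear_eq_on_span[OF assms(1,2) _ tensor_span] assms(3) by blast

lemma tensor_assoc_r_ex:
  "\<exists>L :: (('u::complex_vector, 'v::complex_vector) tensor, 'w::complex_vector) tensor \<Rightarrow> _.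
     clinear L \<and> (\<forall>u v w. L (tens (tens u v) w) = tens u (tens v w))"
proof -
  have "\<exists>K. clinear K \<and> (\<forall>(u::'u) (v::'v). K (tens u v) = tens u (tens v w))" for w :: 'w
  proof -
    have "cbilinear (\<lambda>(u::'u) (v::'v). tens u (tens v w))"
      by (simp add: cbilinear_def clinear_iff tens_simps)
    then show ?thesis
      by (rule tensor_lift_ex)
  qed
  then obtain K where K: "\<And>w::'w. clinear (K w)"
    "\<And>w (u::'u) (v::'v). K w (tens u v) = tens u (tens v w)"
    by metis
  have "K (w + w') = (\<lambda>t. K w t + K w' t)" for w w'
    by (rule tensor_eqI) (use K in \<open>simp_all add: clinear_iff tens_simps algebra_simps scaleC_add_right\<close>)
  moreover have "K (c *\<^sub>C w) = (\<lambda>t. c *\<^sub>C K w t)" for c w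
    by (rule tensor_eqI)
      (use K in \<open>simp_all add: clinear_iff tens_simps algebra_simps scaleC_add_right scaleC_scaleC\<close>)
  ultimately have "cbilinear (\<lambda>t w. K w t)"
    using K(1) by (auto simp: cbilinear_def clinear_iff)
  from tensor_lift_ex[OF this] show ?thesis
    by (auto simp: K(2))
qed

lemma tensor_assoc_l_ex:
  "\<exists>L :: ('u::complex_vector, ('v::complex_vector, 'w::complex_vector) tensor) tensor \<Rightarrow> _.
     clinear L \<and> (\<forall>u v w. L (tens u (tens v w)) = tens (tens u v) w)"
proof -
  have "\<exists>K. clinear K \<and> (\<forall>(v::'v) (w::'w). K (tens v w) = tens (tens u v) w)" for u :: 'u
  proof -
    have "cbilinear (\<lambda>(v::'v) (w::'w). tens (tens u v) w)"
      by (simp add: cbilinear_def clinear_iff tens_simps)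
    then show ?thesis
      by (rule tensor_lift_ex)
  qed
  then obtain K where K: "\<And>u::'u. clinear (K u)"
    "\<And>u (v::'v) (w::'w). K u (tens v w) = tens (tens u v) w"
    by metis
  have "K (u + u') = (\<lambda>t. K u t + K u' t)" for u u'
    by (rule tensor_eqI) (use K in \<open>simp_all add: clinear_iff tens_simps algebra_simps scaleC_add_right\<close>)
  moreover have "K (c *\<^sub>C u) = (\<lambda>t. c *\<^sub>C K u t)" for c u
    by (rule tensor_eqI)
      (use K in \<open>simp_all add: clinear_iff tens_simps algebra_simps scaleC_add_right scaleC_scaleC\<close>)
  ultimately have "cbilinear K"
    using K(1) by (auto simp: cbilinear_def clinear_iff)
  from tensor_lift_ex[OF this] show ?thesis
    by (auto simp: K(2))
qed

lemma lookup_gtens: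
  "Poly_Mapping.lookup (gtens X Y x y) (i, j) =
     (if tgt X i = src Y j then tens (Poly_Mapping.lookup x i) (Poly_Mapping.lookup y j) else 0)"
proof -
  have *: "Poly_Mapping.lookup (if tgt X i' = src Y j' then Poly_Mapping.single (i', j')
        (tens (Poly_Mapping.lookup x i') (Poly_Mapping.lookup y j')) else 0) (i, j) =
      (if i' = i then if j' = j then if tgt X i = src Y j then
        tens (Poly_Mapping.lookup x i) (Poly_Mapping.lookup y j) else 0 else 0 else 0)" for i' j'
    by (simp add: lookup_single when_def)
  have "Poly_Mapping.lookup (gtens X Y x y) (i, j) = (\<Sum>i'\<in>Poly_Mapping.keys x. if i' = i then
      (\<Sum>j'\<in>Poly_Mapping.keys y. if j' = j then if tgt X i = src Y j then
        tens (Poly_Mapping.lookup x i) (Poly_Mapping.lookup y j) else 0 else 0) else 0)"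
    unfolding gtens_def lookup_sum * by (intro sum.cong) auto
  also have "\<dots> = (if tgt X i = src Y j then tens (Poly_Mapping.lookup x i) (Poly_Mapping.lookup y j) else 0)"
    by (simp add: sum.delta') (auto simp: in_keys_iff tens_simps)
  finally show ?thesis .
qed

lemma cbilinear_gtens: "cbilinear (gtens X Y)"
  unfolding cbilinear_def clinear_iff
  by (auto intro!: poly_mapping_eqI simp: lookup_gtens lookup_add lookup_scaleC tens_simps split: prod.split)

lemma gtens_sum:
  "gtens X Y (sum f A) (sum g B) = (\<Sum>i\<in>A. \<Sum>j\<in>B. gtens X Y (f i) (g j))"
proof -
  have "clinear (\<lambda>x. gtens X Y x (sum g B))" and *: "clinear (gtens X Y x)" for x
    using cbilinear_gtens[of X Y] by (simp_all add: cbilinear_def)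
  from clinear_sum[OF this(1)] show ?thesis
    by (simp add: clinear_sum[OF *])
qed

lemma gtens_single:
  "gtens X Y (Poly_Mapping.single i v) (Poly_Mapping.single j w) =
     (if tgt X i = src Y j then Poly_Mapping.single (i, j) (tens v w) else 0)"
  by (auto intro!: poly_mapping_eqI simp: lookup_gtens lookup_single when_def tens_simps)

definition subspaces :: "('i, 'o, 'p, 'v::complex_vector) gspace \<Rightarrow> bool" where
  "subspaces X \<longleftrightarrow> (\<forall>i\<in>arr X. cvec.subspace (fib X i))"

lemma finite_type_subspaces: "finite_type S V \<Longrightarrow> subspaces (gr S V)"
  by (auto simp: finite_type_def subspaces_def gr_def)

lemma subspaces_gtensor: "subspaces (X \<otimes>\<^sub>g Y)"
  by (auto simp: subspaces_def gtensor_def gr_def comp_arrows_def tensor_fib_def)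

lemma total_iff:
  assumes "subspaces X"
  shows "x \<in> total_space X \<longleftrightarrow>
    (\<forall>i. Poly_Mapping.lookup x i \<in> (if i \<in> arr X then fib X i else {0}))"
proof
  assume x: "x \<in> total_space X"
  show "\<forall>i. Poly_Mapping.lookup x i \<in> (if i \<in> arr X then fib X i else {0})"
  proof
    fix i
    show "Poly_Mapping.lookup x i \<in> (if i \<in> arr X then fib X i else {0})"
      using x assms by (cases "Poly_Mapping.lookup x i = 0")
        (auto simp: total_space_def in_keys_iff subspaces_def cvec.subspace_0)
  qed
qed (auto simp: total_space_def in_keys_iff split: if_splits)

lemma subspace_total_space:
  assumes X: "subspaces X"
  shows "cvec.subspace (total_space X)"
proof -
  have S: "cvec.subspace (if i \<in> arr X then fib X i else {0})" for i
    using X by (simp add: subspaces_def cvec.subspace_single_0)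
  show ?thesis
    by (rule cvec.subspaceI)
      (use S in \<open>simp_all add: total_iff[OF X] lookup_add lookup_scaleC
        cvec.subspace_0 cvec.subspace_add cvec.subspace_scale del: if_split_mem1 if_split_mem2 split del: if_split\<close>)
qed

lemma single_in_total: "i \<in> arr X \<Longrightarrow> v \<in> fib X i \<Longrightarrow> Poly_Mapping.single i v \<in> total_space X"
  by (auto simp: total_space_def)

lemma linear_onD:
  assumes "linear_on S f"
  shows "x \<in> S \<Longrightarrow> y \<in> S \<Longrightarrow> f (x + y) = f x + f y" "x \<in> S \<Longrightarrow> f (c *\<^sub>C x) = c *\<^sub>C f x"
  using assms by (auto simp: linear_on_def)

lemma linear_on_eq_span:
  assumes f: "linear_on (cvec.span S) f" and g: "linear_on (cvec.span S) g"
    and eq: "\<And>x. x \<in> S \<Longrightarrow> f x = g x" and x: "x \<in> cvec.span S"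
  shows "f x = g x"
proof -
  have "x \<in> cvec.span S \<and> f x = g x"
    using x
  proof (induction rule: cvec.span_induct_alt)
    case base
    show ?case
      using linear_onD(2)[OF f cvec.span_zero, of 0] linear_onD(2)[OF g cvec.span_zero, of 0]
      by (simp add: cvec.span_zero)
  next
    case (step c x y)
    then show ?case
      by (simp add: eq cvec.span_add cvec.span_scale cvec.span_base linear_onD[OF f] linear_onD[OF g])
  qed
  then show ?thesis ..
qed

lemma linear_on_extend:
  fixes f :: "'a::complex_vector \<Rightarrow> 'b::complex_vector"
  assumes S: "cvec.subspace S" and f: "linear_on S f"
  obtains g where "clinear g" "\<And>x. x \<in> S \<Longrightarrow> g x = f x"
proof -
  interpret p: vector_space_pair "scaleC :: complex \<Rightarrow> 'a \<Rightarrow> 'a" "scaleC :: complex \<Rightarrow> 'b \<Rightarrow> 'b"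
    by (simp add: vector_space_pair_def cvec.vector_space_axioms)
  obtain B where B: "B \<subseteq> S" "cvec.independent B" "S \<subseteq> cvec.span B"
    by (rule cvec.maximal_independent_subset)
  then have span: "cvec.span B = S"
    using S by (simp add: cvec.span_minimal subset_antisym)
  obtain g where g: "clinear g" "\<And>x. x \<in> B \<Longrightarrow> g x = f x"
    using p.linear_independent_extend[OF B(2)] by blast
  have "linear_on S g"
    using g(1) by (auto simp: linear_on_def clinear_iff)
  then show thesis
    using that[OF g(1)] linear_on_eq_span[of B g f] g(2) f unfolding span by blast
qed

lemma gtens_in_total:
  assumes "x \<in> total_space X" "y \<in> total_space Y"
  shows "gtens X Y x y \<in> total_space (X \<otimes>\<^sub>g Y)"
proof -
  have "(i, j) \<in> arr (X \<otimes>\<^sub>g Y) \<and> Poly_Mapping.lookup (gtens X Y x y) (i, j) \<in> fib (X \<otimes>\<^sub>g Y) (i, j)"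
    if "(i, j) \<in> Poly_Mapping.keys (gtens X Y x y)" for i j
  proof -
    from that have c: "tgt X i = src Y j"
      and "tens (Poly_Mapping.lookup x i) (Poly_Mapping.lookup y j) \<noteq> 0"
      by (auto simp: in_keys_iff lookup_gtens split: if_splits)
    then have "i \<in> Poly_Mapping.keys x" "j \<in> Poly_Mapping.keys y"
      by (metis in_keys_iff tens_simps(5,6))+
    with assms c show ?thesis
      by (auto simp: total_space_def lookup_gtens gtensor_def gr_def comp_arrows_def tensor_fib_def
          intro!: cvec.span_base)
  qed
  then show ?thesis
    by (auto simp: total_space_def)
qed

lemma clinear_single: "clinear (Poly_Mapping.single k :: 'a::complex_vector \<Rightarrow> _)"
  by (auto simp: clinear_iff intro!: poly_mapping_eqI simp: lookup_add lookup_scaleC lookup_single when_def)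

lemma total_gtensor:
  assumes "subspaces X" "subspaces Y"
  shows "total_space (X \<otimes>\<^sub>g Y) = cvec.span {gtens X Y x y | x y. x \<in> total_space X \<and> y \<in> total_space Y}"
    (is "_ = cvec.span ?G")
proof
  show "cvec.span ?G \<subseteq> total_space (X \<otimes>\<^sub>g Y)"
    by (rule cvec.span_minimal) (auto intro: gtens_in_total subspace_total_space subspaces_gtensor)
  show "total_space (X \<otimes>\<^sub>g Y) \<subseteq> cvec.span ?G"
  proof
    fix z assume z: "z \<in> total_space (X \<otimes>\<^sub>g Y)"
    have *: "Poly_Mapping.single (i, j) (Poly_Mapping.lookup z (i, j)) \<in> cvec.span ?G"
      if "(i, j) \<in> Poly_Mapping.keys z" for i j
    proof -
      from z that have ij: "i \<in> arr X" "j \<in> arr Y" "tgt X i = src Y j"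
        and "Poly_Mapping.lookup z (i, j) \<in> cvec.span {tens v w | v w. v \<in> fib X i \<and> w \<in> fib Y j}"
        by (auto simp: total_space_def gtensor_def gr_def comp_arrows_def tensor_fib_def)
      from this(4) show ?thesis
      proof (induction rule: cvec.span_induct_alt)
        case base
        show ?case
          by (simp add: cvec.span_zero)
      next
        case (step c t t')
        then obtain v w where t: "t = tens v w" "v \<in> fib X i" "w \<in> fib Y j"
          by blast
        have "Poly_Mapping.single (i, j) t = gtens X Y (Poly_Mapping.single i v) (Poly_Mapping.single j w)"
          by (simp add: gtens_single ij t)
        then have "Poly_Mapping.single (i, j) t \<in> cvec.span ?G"
          using single_in_total[OF ij(1) t(2)] single_in_total[OF ij(2) t(3)]
          by (intro cvec.span_base) blast
        with step show ?case
          by (simp add: clinear_add[OF clinear_single] clinear_scale[OF clinear_single]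
              cvec.span_add cvec.span_scale)
      qed
    qed
    have "(\<Sum>k\<in>Poly_Mapping.keys z. Poly_Mapping.single k (Poly_Mapping.lookup z k)) \<in> cvec.span ?G"
    proof (rule cvec.span_sum)
      fix k assume "k \<in> Poly_Mapping.keys z"
      then show "Poly_Mapping.single k (Poly_Mapping.lookup z k) \<in> cvec.span ?G"
        by (cases k) (simp add: *)
    qed
    then show "z \<in> cvec.span ?G"
      by (subst poly_mapping_eq_sum_single)
  qed
qed

lemma total_gtensor_gtensor_l:
  assumes "subspaces X" "subspaces Y" "subspaces Z"
  shows "total_space ((X \<otimes>\<^sub>g Y) \<otimes>\<^sub>g Z) = cvec.span
    {gtens (X \<otimes>\<^sub>g Y) Z (gtens X Y x y) z | x y z. x \<in> total_space X \<and> y \<in> total_space Y \<and> z \<in> total_space Z}"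
    (is "_ = cvec.span ?G")
proof
  show "cvec.span ?G \<subseteq> total_space ((X \<otimes>\<^sub>g Y) \<otimes>\<^sub>g Z)"
    by (rule cvec.span_minimal) (auto intro: gtens_in_total subspace_total_space subspaces_gtensor)
  note b = cbilinearD[OF cbilinear_gtens]
  have "gtens (X \<otimes>\<^sub>g Y) Z t z \<in> cvec.span ?G" if "t \<in> total_space (X \<otimes>\<^sub>g Y)" "z \<in> total_space Z" for t z
    using that(1) unfolding total_gtensor[OF assms(1,2)]
    by (induction rule: cvec.span_induct_alt)
      (use that(2) in \<open>auto simp: b cvec.span_zero intro!: cvec.span_add cvec.span_scale intro: cvec.span_base\<close>)
  then show "total_space ((X \<otimes>\<^sub>g Y) \<otimes>\<^sub>g Z) \<subseteq> cvec.span ?G"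
    unfolding total_gtensor[OF subspaces_gtensor assms(3)] by (intro cvec.span_minimal) auto
qed

lemma total_gtensor_gtensor_r:
  assumes "subspaces X" "subspaces Y" "subspaces Z"
  shows "total_space (X \<otimes>\<^sub>g (Y \<otimes>\<^sub>g Z)) = cvec.span
    {gtens X (Y \<otimes>\<^sub>g Z) x (gtens Y Z y z) | x y z. x \<in> total_space X \<and> y \<in> total_space Y \<and> z \<in> total_space Z}"
    (is "_ = cvec.span ?G")
proof
  show "cvec.span ?G \<subseteq> total_space (X \<otimes>\<^sub>g (Y \<otimes>\<^sub>g Z))"
    by (rule cvec.span_minimal) (auto intro: gtens_in_total subspace_total_space subspaces_gtensor)
  note b = cbilinearD[OF cbilinear_gtens]
  have "gtens X (Y \<otimes>\<^sub>g Z) x t \<in> cvec.span ?G" if "t \<in> total_space (Y \<otimes>\<^sub>g Z)" "x \<in> total_space X" for t x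
    using that(1) unfolding total_gtensor[OF assms(2,3)]
    by (induction rule: cvec.span_induct_alt)
      (use that(2) in \<open>auto simp: b cvec.span_zero intro!: cvec.span_add cvec.span_scale intro: cvec.span_base\<close>)
  then show "total_space (X \<otimes>\<^sub>g (Y \<otimes>\<^sub>g Z)) \<subseteq> cvec.span ?G"
    unfolding total_gtensor[OF assms(1) subspaces_gtensor] by (intro cvec.span_minimal) auto
qed

lemma Hom_keys:
  assumes "f \<in> Hom X Y" "i \<in> arr X" "v \<in> fib X i" "k \<in> Poly_Mapping.keys (f (Poly_Mapping.single i v))"
  shows "src Y k = src X i" "tgt Y k = tgt X i"
proof -
  have "\<forall>i'\<in>Poly_Mapping.keys (Poly_Mapping.single i v). src X i' = src X i \<and> tgt X i' = tgt X i"
    by auto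
  then show "src Y k = src X i" "tgt Y k = tgt X i"
    using assms single_in_total[OF assms(2,3)] unfolding Hom_def by blast+
qed

lemma ex1_on_span:
  assumes T: "T = cvec.span S" and P: "\<And>h. P h \<longleftrightarrow> (\<forall>s\<in>S. h s = r s)"
    and L: "clinear L" "\<And>s. s \<in> S \<Longrightarrow> L s = r s"
  shows "\<exists>!h. linear_on T h \<and> P h \<and> (\<forall>t. t \<notin> T \<longrightarrow> h t = 0)"
proof (rule ex1I[of _ "\<lambda>t. if t \<in> T then L t else 0"])
  show "linear_on T (\<lambda>t. if t \<in> T then L t else 0) \<and> P (\<lambda>t. if t \<in> T then L t else 0) \<and>
      (\<forall>t. t \<notin> T \<longrightarrow> (if t \<in> T then L t else 0) = 0)"
    using L by (auto simp: linear_on_def P T clinear_iff cvec.span_add cvec.span_scale cvec.span_base)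
  fix h assume h: "linear_on T h \<and> P h \<and> (\<forall>t. t \<notin> T \<longrightarrow> h t = 0)"
  have "linear_on (cvec.span S) L"
    using L(1) by (auto simp: linear_on_def clinear_iff)
  then show "h = (\<lambda>t. if t \<in> T then L t else 0)"
    using h linear_on_eq_span[of S h L] L(2) by (auto simp: T P)
qed

lemma map_gtensor:
  assumes X: "subspaces X" and Y: "subspaces Y" and f: "f \<in> Hom X X'" and g: "g \<in> Hom Y Y'"
  shows "is_map_gtensor X Y X' Y' f g (map_gtensor X Y X' Y' f g)"
proof -
  obtain f' where f': "clinear f'" "\<And>x. x \<in> total_space X \<Longrightarrow> f' x = f x"
    by (rule linear_on_extend[OF subspace_total_space[OF X], of f]) (use f in \<open>auto simp: Hom_def\<close>)
  obtain g' where g': "clinear g'" "\<And>y. y \<in> total_space Y \<Longrightarrow> g' y = g y"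
    by (rule linear_on_extend[OF subspace_total_space[OF Y], of g]) (use g in \<open>auto simp: Hom_def\<close>)
  note b = cbilinearD[OF cbilinear_gtens]
  define S where "S = (\<lambda>i v j w. gtens X' Y' (f' (Poly_Mapping.single i v)) (g' (Poly_Mapping.single j w)))"
  have "\<exists>L. clinear L \<and> (\<forall>v w. L (tens v w) = S i v j w)" for i j
  proof -
    have "cbilinear (\<lambda>v w. S i v j w)"
      by (auto simp: cbilinear_def clinear_iff S_def b clinear_add[OF clinear_single]
          clinear_scale[OF clinear_single] clinear_add[OF f'(1)] clinear_add[OF g'(1)]
          clinear_scale[OF f'(1)] clinear_scale[OF g'(1)])
    then show ?thesis
      by (rule tensor_lift_ex)
  qed
  then obtain L' where L': "\<And>i j. clinear (L' i j)" "\<And>i j v w. L' i j (tens v w) = S i v j w"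
    by metis
  define L where "L = (\<lambda>(i, j). L' i j)"
  have L: "clinear (L k)" "L (i, j) (tens v w) = S i v j w" for k i j v w
    by (simp_all add: L_def L' split: prod.split)
  define h where "h z = (\<Sum>k\<in>Poly_Mapping.keys z. L k (Poly_Mapping.lookup z k))" for z
  have h: "clinear h"
    unfolding h_def by (rule clinear_sum_keys) (rule L)
  have hs: "h (Poly_Mapping.single k t) = L k t" for k t
    by (cases "t = 0") (simp_all add: h_def clinear_0[OF L(1)])
  have S0: "S i (Poly_Mapping.lookup x i) j (Poly_Mapping.lookup y j) = 0"
    if "x \<in> total_space X" "y \<in> total_space Y" "i \<in> Poly_Mapping.keys x" "j \<in> Poly_Mapping.keys y" "tgt X i \<noteq> src Y j" for x y i j
  proof -
    from that have i: "i \<in> arr X" "Poly_Mapping.lookup x i \<in> fib X i"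
      and j: "j \<in> arr Y" "Poly_Mapping.lookup y j \<in> fib Y j"
      by (auto simp: total_space_def)
    let ?v = "Poly_Mapping.lookup x i" and ?w = "Poly_Mapping.lookup y j"
    have S: "S i ?v j ?w = gtens X' Y' (f (Poly_Mapping.single i ?v)) (g (Poly_Mapping.single j ?w))"
      by (simp add: S_def f'(2) g'(2) single_in_total i j)
    show ?thesis
      unfolding S gtens_def
      using Hom_keys(2)[OF f i] Hom_keys(1)[OF g j] that(5) by (intro sum.neutral ballI) auto
  qed
  have hg: "h (gtens X Y x y) = gtens X' Y' (f x) (g y)" if "x \<in> total_space X" "y \<in> total_space Y" for x y
  proof -
    have "gtens X' Y' (f x) (g y) = gtens X' Y' (f' x) (g' y)"
      by (simp add: that f' g')
    also have "\<dots> = gtens X' Y'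
        (\<Sum>i\<in>Poly_Mapping.keys x. f' (Poly_Mapping.single i (Poly_Mapping.lookup x i)))
        (\<Sum>j\<in>Poly_Mapping.keys y. g' (Poly_Mapping.single j (Poly_Mapping.lookup y j)))"
      by (simp flip: clinear_sum[OF f'(1)] clinear_sum[OF g'(1)] poly_mapping_eq_sum_single)
    also have "\<dots> = (\<Sum>i\<in>Poly_Mapping.keys x. \<Sum>j\<in>Poly_Mapping.keys y.
        S i (Poly_Mapping.lookup x i) j (Poly_Mapping.lookup y j))"
      unfolding S_def by (rule gtens_sum)
    also have "\<dots> = (\<Sum>i\<in>Poly_Mapping.keys x. \<Sum>j\<in>Poly_Mapping.keys y.
        h (if tgt X i = src Y j then Poly_Mapping.single (i, j)
          (tens (Poly_Mapping.lookup x i) (Poly_Mapping.lookup y j)) else 0))"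
      by (intro sum.cong refl) (auto simp: hs L(2) clinear_0[OF h] S0[OF that])
    also have "\<dots> = h (gtens X Y x y)"
      by (simp add: gtens_def clinear_sum[OF h])
    finally show ?thesis ..
  qed
  have "\<exists>!k. is_map_gtensor X Y X' Y' f g k"
    unfolding is_map_gtensor_def
    by (rule ex1_on_span[OF total_gtensor[OF X Y], where r = h and L = h])
      (use h in \<open>fastforce simp flip: hg\<close>)+
  then show ?thesis
    unfolding map_gtensor_def by (rule theI')
qed

lemma gtensor_sel [simp]:
  "src (X \<otimes>\<^sub>g Y) (i, j) = src X i" "tgt (X \<otimes>\<^sub>g Y) (i, j) = tgt Y j"
  by (simp_all add: gtensor_def gr_def comp_arrows_def)

lemma reindex_ex:
  fixes L :: "'a::complex_vector \<Rightarrow> 'b::complex_vector"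
  assumes L: "clinear L" and e: "\<And>k l. e k = l \<longleftrightarrow> k = e' l"
  shows "\<exists>h. clinear h \<and> (\<forall>z l. Poly_Mapping.lookup (h z) l = L (Poly_Mapping.lookup z (e' l)))"
proof -
  define h where "h z = (\<Sum>k\<in>Poly_Mapping.keys z. Poly_Mapping.single (e k) (L (Poly_Mapping.lookup z k)))" for z
  have "clinear (\<lambda>v. Poly_Mapping.single (e k) (L v))" for k
    by (simp add: clinear_iff clinear_add[OF L] clinear_scale[OF L]
        clinear_add[OF clinear_single] clinear_scale[OF clinear_single])
  then have "clinear h"
    unfolding h_def by (rule clinear_sum_keys)
  moreover have "Poly_Mapping.lookup (h z) l = L (Poly_Mapping.lookup z (e' l))" for z l
    by (auto simp: h_def lookup_sum lookup_single when_def e in_keys_iff clinear_0[OF L])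
  ultimately show ?thesis
    by blast
qed

lemma assoc_r:
  fixes X :: "('i, 'o, 'p, 'u::complex_vector) gspace" and Y :: "('j, 'p, 'q, 'v::complex_vector) gspace"
    and Z :: "('k, 'q, 'r, 'w::complex_vector) gspace"
  assumes "subspaces X" "subspaces Y" "subspaces Z"
  shows "is_assoc_r X Y Z (assoc_r X Y Z)"
proof -
  obtain L :: "(('u, 'v) tensor, 'w) tensor \<Rightarrow> _" where L: "clinear L" "\<And>u v w. L (tens (tens u v) w) = tens u (tens v w)"
    using tensor_assoc_r_ex by blast
  have "\<exists>h. clinear h \<and> (\<forall>z l. Poly_Mapping.lookup (h z) l =
      L (Poly_Mapping.lookup z ((\<lambda>(i::'i, j::'j, k::'k). ((i, j), k)) l)))"
    by (rule reindex_ex[OF L(1), of "\<lambda>((i::'i, j::'j), k::'k). (i, j, k)"]) auto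
  then obtain h where h: "clinear h" "\<And>z l. Poly_Mapping.lookup (h z) l =
      L (Poly_Mapping.lookup z ((\<lambda>(i::'i, j::'j, k::'k). ((i, j), k)) l))"
    by blast
  have hg: "h (gtens (X \<otimes>\<^sub>g Y) Z (gtens X Y x y) z) = gtens X (Y \<otimes>\<^sub>g Z) x (gtens Y Z y z)" for x y z
    by (rule poly_mapping_eqI)
      (auto simp: h(2) lookup_gtens L(2) clinear_0[OF L(1)] tens_simps)
  have "\<exists>!k. is_assoc_r X Y Z k"
    unfolding is_assoc_r_def
    by (rule ex1_on_span[OF total_gtensor_gtensor_l[OF assms], where r = h and L = h])
      (use h(1) in \<open>fastforce simp flip: hg\<close>)+
  then show ?thesis
    unfolding assoc_r_def by (rule theI')
qed

lemma assoc_l: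
  fixes X :: "('i, 'o, 'p, 'u::complex_vector) gspace" and Y :: "('j, 'p, 'q, 'v::complex_vector) gspace"
    and Z :: "('k, 'q, 'r, 'w::complex_vector) gspace"
  assumes "subspaces X" "subspaces Y" "subspaces Z"
  shows "is_assoc_l X Y Z (assoc_l X Y Z)"
proof -
  obtain L :: "('u, ('v, 'w) tensor) tensor \<Rightarrow> _" where L: "clinear L" "\<And>u v w. L (tens u (tens v w)) = tens (tens u v) w"
    using tensor_assoc_l_ex by blast
  have "\<exists>h. clinear h \<and> (\<forall>z l. Poly_Mapping.lookup (h z) l =
      L (Poly_Mapping.lookup z ((\<lambda>((i::'i, j::'j), k::'k). (i, j, k)) l)))"
    by (rule reindex_ex[OF L(1), of "\<lambda>(i::'i, j::'j, k::'k). ((i, j), k)"]) auto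
  then obtain h where h: "clinear h" "\<And>z l. Poly_Mapping.lookup (h z) l =
      L (Poly_Mapping.lookup z ((\<lambda>((i::'i, j::'j), k::'k). (i, j, k)) l))"
    by blast
  have hg: "h (gtens X (Y \<otimes>\<^sub>g Z) x (gtens Y Z y z)) = gtens (X \<otimes>\<^sub>g Y) Z (gtens X Y x y) z" for x y z
    by (rule poly_mapping_eqI)
      (auto simp: h(2) lookup_gtens L(2) clinear_0[OF L(1)] tens_simps)
  have "\<exists>!k. is_assoc_l X Y Z k"
    unfolding is_assoc_l_def
    by (rule ex1_on_span[OF total_gtensor_gtensor_r[OF assms], where r = h and L = h])
      (use h(1) in \<open>fastforce simp flip: hg\<close>)+
  then show ?thesis
    unfolding assoc_l_def by (rule theI')
qed

end

theory Submission
  imports Defs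
begin

text \<open>On four tensor factors, \<open>C\<close> on factors 1, 2 and \<open>D\<close> on factors 3, 4 act on disjoint pairs, so they
  commute and \<open>D\<^sup>2\<^sup>3 C\<^sup>1\<^sup>2 D\<^sup>3\<^sup>4 C\<^sup>2\<^sup>3 = (D\<^sup>2\<^sup>3 D\<^sup>3\<^sup>4) (C\<^sup>1\<^sup>2 C\<^sup>2\<^sup>3)\<close>. The relation for \<open>C\<close>, with the last
  factor as a spectator, moves \<open>R\<^sub>1\<^sup>1\<^sup>2\<close> through \<open>C\<^sup>1\<^sup>2 C\<^sup>2\<^sup>3\<close> and turns it into \<open>R\<^sub>2\<^sup>2\<^sup>3\<close>; the relation
  for \<open>D\<close>, with the first factor as a spectator, then moves \<open>R\<^sub>2\<^sup>2\<^sup>3\<close> through \<open>D\<^sup>2\<^sup>3 D\<^sup>3\<^sup>4\<close> and turns it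
  into \<open>R\<^sub>3\<^sup>3\<^sup>4\<close>. This is \<open>composite_relation\<close>.

  The work lies in the associators that this picture suppresses. It is organised around two
  operations that add a last factor: \<open>snoc\<close> sends \<open>p \<in> X \<otimes> Y\<close> and \<open>w \<in> Z\<close> to the element
  \<open>p \<otimes> w\<close> of \<open>X \<otimes> (Y \<otimes> Z)\<close>, and \<open>snoc2\<close> sends \<open>t \<in> X \<otimes> (Y \<otimes> Z)\<close> and \<open>w \<in> W\<close> to the
  element \<open>t \<otimes> w\<close> of \<open>X \<otimes> (Y \<otimes> (Z \<otimes> W))\<close>. Their values span, and on them the operators
  \<open>head\<close> and \<open>tail\<close> act as one expects (\<open>head_snoc\<close>, \<open>head_snoc2\<close>, \<open>tail_head_snoc2\<close>), so each
  coherence identity needs a check on such generators only. For an identity between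
  meromorphic functions of \<open>z\<close> this is legitimate because a vector is a finite combination
  of generators, and finitely many exceptional sets have an admissible union
  (\<open>eventually_eq_on_span\<close>).

  As an intertwiner for the connecting set of composable pairs, the composite carries the
  bracketing \<open>(V \<otimes> W) \<otimes> V\<^sub>3\<close> on its target. By \<open>rebracketed_composite\<close>, the corresponding
  products of operators differ only by the associator
  \<open>(V \<otimes> W) \<otimes> (V\<^sub>3 \<otimes> V\<^sub>3) \<rightarrow> V \<otimes> (W \<otimes> (V\<^sub>3 \<otimes> V\<^sub>3))\<close>, which is injective and natural.\<close>

section \<open>Linear maps between subspaces\<close>

text \<open>Linearity and the range condition are bundled because only together are they stable under
  composition, when linearity is required on a subspace only.\<close>

definition linear_into :: "'a::complex_vector set \<Rightarrow> 'b::complex_vector set \<Rightarrow> ('a \<Rightarrow> 'b) \<Rightarrow> bool" where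
  "linear_into S T f \<longleftrightarrow> linear_on S f \<and> f ` S \<subseteq> T"

lemma linear_into_comp:
  assumes "linear_into S T f" "linear_into T U g"
  shows "linear_into S U (\<lambda>x. g (f x))"
  using assms by (auto simp: linear_into_def linear_on_def image_subset_iff)

lemma linear_into_mem: "linear_into S T f \<Longrightarrow> x \<in> S \<Longrightarrow> f x \<in> T"
  by (auto simp: linear_into_def)

lemma linear_into_zero:
  assumes "linear_into S T f" "cvec.subspace S"
  shows "f 0 = 0"
proof -
  have "f (0 *\<^sub>C 0) = 0 *\<^sub>C f 0"
    using assms unfolding linear_into_def by (intro linear_onD(2)) (auto simp: cvec.subspace_0)
  then show ?thesis by simp
qed

lemma linear_into_sum:
  assumes f: "linear_into S T f" and S: "cvec.subspace S" and g: "\<And>i. i \<in> A \<Longrightarrow> g i \<in> S"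
  shows "f (sum g A) = (\<Sum>i\<in>A. f (g i))"
  using g
proof (induction A rule: infinite_finite_induct)
  case (insert i A)
  then have "g i \<in> S" "sum g A \<in> S"
    using S by (auto intro: cvec.subspace_sum)
  then have "f (g i + sum g A) = f (g i) + f (sum g A)"
    using f unfolding linear_into_def by (blast intro: linear_onD)
  with insert show ?case by simp
qed (simp_all add: linear_into_zero[OF f S])

lemma subspace_preimage:
  assumes f: "linear_into S T f" and S: "cvec.subspace S" and U: "cvec.subspace U"
  shows "cvec.subspace {x \<in> S. f x \<in> U}"
proof (rule cvec.subspaceI)
  have l: "linear_on S f" using f by (simp add: linear_into_def)
  show "0 \<in> {x \<in> S. f x \<in> U}"
    using linear_into_zero[OF f S] S U by (simp add: cvec.subspace_0)
  show "x + y \<in> {x \<in> S. f x \<in> U}" if "x \<in> {x \<in> S. f x \<in> U}" "y \<in> {x \<in> S. f x \<in> U}" for x y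
    using that S U by (simp add: linear_onD[OF l] cvec.subspace_add)
  show "c *\<^sub>C x \<in> {x \<in> S. f x \<in> U}" if "x \<in> {x \<in> S. f x \<in> U}" for c x
    using that S U by (simp add: linear_onD[OF l] cvec.subspace_scale)
qed

text \<open>A filter is closed under finite intersections, so equality for almost all \<open>z\<close>, with an
  exceptional set that depends on the vector, is still a linear condition on the vector.\<close>

lemma subspace_eventually_eq:
  assumes f: "\<And>z. linear_into S T (f z)" and g: "\<And>z. linear_into S T (g z)" and S: "cvec.subspace S"
  shows "cvec.subspace {x \<in> S. \<forall>\<^sub>F z in F. f z x = g z x}"
proof (rule cvec.subspaceI)
  have l: "linear_on S (f z)" "linear_on S (g z)" for z using f g by (simp_all add: linear_into_def)
  show "0 \<in> {x \<in> S. \<forall>\<^sub>F z in F. f z x = g z x}"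
    using linear_into_zero[OF f S] linear_into_zero[OF g S] S by (simp add: cvec.subspace_0)
  show "x + y \<in> {x \<in> S. \<forall>\<^sub>F z in F. f z x = g z x}"
    if x: "x \<in> {x \<in> S. \<forall>\<^sub>F z in F. f z x = g z x}" and y: "y \<in> {x \<in> S. \<forall>\<^sub>F z in F. f z x = g z x}" for x y
  proof -
    from x have "\<forall>\<^sub>F z in F. f z x = g z x" by simp
    moreover from y have "\<forall>\<^sub>F z in F. f z y = g z y" by simp
    ultimately have "\<forall>\<^sub>F z in F. f z (x + y) = g z (x + y)"
      by eventually_elim (use x y in \<open>simp add: linear_onD[OF l(1)] linear_onD[OF l(2)]\<close>)
    then show ?thesis using x y S by (simp add: cvec.subspace_add)
  qed
  show "c *\<^sub>C x \<in> {x \<in> S. \<forall>\<^sub>F z in F. f z x = g z x}"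
    if x: "x \<in> {x \<in> S. \<forall>\<^sub>F z in F. f z x = g z x}" for c x
  proof -
    from x have "\<forall>\<^sub>F z in F. f z x = g z x" by simp
    then have "\<forall>\<^sub>F z in F. f z (c *\<^sub>C x) = g z (c *\<^sub>C x)"
      by eventually_elim (use x in \<open>simp add: linear_onD[OF l(1)] linear_onD[OF l(2)]\<close>)
    then show ?thesis using x S by (simp add: cvec.subspace_scale)
  qed
qed

lemma eventually_eq_on_span:
  assumes f: "\<And>z. linear_into (cvec.span G) T (f z)" and g: "\<And>z. linear_into (cvec.span G) T (g z)"
    and eq: "\<And>x. x \<in> G \<Longrightarrow> \<forall>\<^sub>F z in F. f z x = g z x" and x: "x \<in> cvec.span G"
  shows "\<forall>\<^sub>F z in F. f z x = g z x"
proof -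
  have "G \<subseteq> {x \<in> cvec.span G. \<forall>\<^sub>F z in F. f z x = g z x}"
    using eq by (auto intro: cvec.span_base)
  from cvec.span_minimal[OF this subspace_eventually_eq[OF f g cvec.subspace_span]] x
  show ?thesis by auto
qed

lemma linear_into_eq_on_span:
  assumes "linear_into (cvec.span G) T f" "linear_into (cvec.span G) T' g"
    and "\<And>x. x \<in> G \<Longrightarrow> f x = g x" "x \<in> cvec.span G"
  shows "f x = g x"
  using assms linear_on_eq_span[of G f g x] by (auto simp: linear_into_def)


section \<open>Homogeneous components\<close>

definition homogeneous :: "('i, 'o, 'p, 'v::complex_vector) gspace \<Rightarrow> 'o \<Rightarrow> 'p \<Rightarrow> ('i \<Rightarrow>\<^sub>0 'v) set" where
  "homogeneous X a b = {x \<in> total_space X. \<forall>i\<in>Poly_Mapping.keys x. src X i = a \<and> tgt X i = b}"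

lemma subspace_homogeneous:
  assumes "subspaces X"
  shows "cvec.subspace (homogeneous X a b)"
proof -
  have T: "cvec.subspace (total_space X)"
    by (rule subspace_total_space[OF assms])
  have k: "Poly_Mapping.keys (c *\<^sub>C x) \<subseteq> Poly_Mapping.keys x" for c and x :: "'a \<Rightarrow>\<^sub>0 'd"
    by (auto simp: in_keys_iff lookup_scaleC)
  show ?thesis
    unfolding homogeneous_def
    by (rule cvec.subspaceI)
      (use T k Poly_Mapping.keys_add in \<open>fastforce simp: cvec.subspace_0 cvec.subspace_add cvec.subspace_scale\<close>)+
qed

text \<open>Preservation of source and target, recast as preservation of homogeneous components, which
  are subspaces and hence compatible with arguments by spanning sets.\<close>

lemma Hom_iff:
  "f \<in> Hom X Y \<longleftrightarrow> linear_into (total_space X) (total_space Y) f \<and>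
     (\<forall>a b. f ` homogeneous X a b \<subseteq> homogeneous Y a b)"
  unfolding Hom_def linear_into_def homogeneous_def image_subset_iff by fastforce

lemma Hom_linear_into: "f \<in> Hom X Y \<Longrightarrow> linear_into (total_space X) (total_space Y) f"
  by (simp add: Hom_iff)

lemma Hom_mem: "f \<in> Hom X Y \<Longrightarrow> x \<in> total_space X \<Longrightarrow> f x \<in> total_space Y"
  by (auto simp: Hom_def)

lemma Hom_homogeneous: "f \<in> Hom X Y \<Longrightarrow> x \<in> homogeneous X a b \<Longrightarrow> f x \<in> homogeneous Y a b"
  by (auto simp: Hom_iff)

lemma id_Hom: "id \<in> Hom X X"
  by (auto simp: Hom_iff linear_into_def linear_on_def)

lemma Hom_comp: "f \<in> Hom X Y \<Longrightarrow> g \<in> Hom Y Z \<Longrightarrow> g \<circ> f \<in> Hom X Z"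
  using linear_into_comp[of "total_space X" "total_space Y" f "total_space Z" g]
  by (auto simp: Hom_iff image_subset_iff comp_def)

lemma HomI_singles:
  assumes X: "subspaces X" and Y: "subspaces Y" and f: "linear_on (total_space X) f"
    and s: "\<And>i v. i \<in> arr X \<Longrightarrow> v \<in> fib X i \<Longrightarrow>
      f (Poly_Mapping.single i v) \<in> homogeneous Y (src X i) (tgt X i)"
  shows "f \<in> Hom X Y"
proof -
  have l: "linear_into (total_space X) UNIV f"
    using f by (simp add: linear_into_def)
  have sing: "i \<in> arr X \<and> Poly_Mapping.lookup x i \<in> fib X i \<and>
      Poly_Mapping.single i (Poly_Mapping.lookup x i) \<in> total_space X"
    if "x \<in> total_space X" "i \<in> Poly_Mapping.keys x" for x i
    using that by (auto simp: total_space_def)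
  have fx: "f x = (\<Sum>i\<in>Poly_Mapping.keys x. f (Poly_Mapping.single i (Poly_Mapping.lookup x i)))"
    if "x \<in> total_space X" for x
    using sing[OF that] by (subst (1) poly_mapping_eq_sum_single)
      (rule linear_into_sum[OF l subspace_total_space[OF X]], blast)
  have "f x \<in> total_space Y" if "x \<in> total_space X" for x
    unfolding fx[OF that]
    by (rule cvec.subspace_sum[OF subspace_total_space[OF Y]])
      (use sing[OF that] s in \<open>auto simp: homogeneous_def\<close>)
  moreover have "f x \<in> homogeneous Y a b" if x: "x \<in> homogeneous X a b" for x a b
  proof -
    from x have xt: "x \<in> total_space X" by (simp add: homogeneous_def)
    show ?thesis
      unfolding fx[OF xt]
    proof (rule cvec.subspace_sum[OF subspace_homogeneous[OF Y]])
      fix i assume i: "i \<in> Poly_Mapping.keys x"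
      with x have "src X i = a" "tgt X i = b" by (auto simp: homogeneous_def)
      with s[of i "Poly_Mapping.lookup x i"] sing[OF xt i]
      show "f (Poly_Mapping.single i (Poly_Mapping.lookup x i)) \<in> homogeneous Y a b" by simp
    qed
  qed
  ultimately show ?thesis
    using f by (auto simp: Hom_iff linear_into_def)
qed

lemma single_homogeneous:
  "i \<in> arr X \<Longrightarrow> v \<in> fib X i \<Longrightarrow> Poly_Mapping.single i v \<in> homogeneous X (src X i) (tgt X i)"
  by (auto simp: homogeneous_def single_in_total)

lemma gtens_homogeneous:
  assumes "x \<in> homogeneous X a c" "y \<in> homogeneous Y d b"
  shows "gtens X Y x y \<in> homogeneous (X \<otimes>\<^sub>g Y) a b"
proof -
  have "i \<in> Poly_Mapping.keys x \<and> j \<in> Poly_Mapping.keys y"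
    if "(i, j) \<in> Poly_Mapping.keys (gtens X Y x y)" for i j
    using that by (auto simp: in_keys_iff lookup_gtens tens_simps split: if_splits)
  then show ?thesis
    using assms gtens_in_total[of x X y Y] by (fastforce simp: homogeneous_def)
qed

lemma single_gtensor_induct:
  assumes k: "(i, j) \<in> arr (X \<otimes>\<^sub>g Y)" "t \<in> fib (X \<otimes>\<^sub>g Y) (i, j)" and U: "cvec.subspace U"
    and s: "\<And>v w. i \<in> arr X \<Longrightarrow> j \<in> arr Y \<Longrightarrow> v \<in> fib X i \<Longrightarrow> w \<in> fib Y j \<Longrightarrow>
      gtens X Y (Poly_Mapping.single i v) (Poly_Mapping.single j w) \<in> U"
  shows "Poly_Mapping.single (i, j) t \<in> U"
proof -
  from k have ij: "i \<in> arr X" "j \<in> arr Y" "tgt X i = src Y j"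
    and t: "t \<in> cvec.span {tens v w | v w. v \<in> fib X i \<and> w \<in> fib Y j}"
    by (auto simp: gtensor_def gr_def comp_arrows_def tensor_fib_def)
  from t show ?thesis
  proof (induction rule: cvec.span_induct_alt)
    case base
    show ?case using U by (simp add: cvec.subspace_0)
  next
    case (step c t t')
    then obtain v w where t: "t = tens v w" "v \<in> fib X i" "w \<in> fib Y j" by blast
    then have "Poly_Mapping.single (i, j) t \<in> U"
      using s[OF ij(1,2) t(2,3)] ij(3) by (simp add: gtens_single)
    with step U show ?case
      by (simp add: clinear_add[OF clinear_single] clinear_scale[OF clinear_single]
          cvec.subspace_add cvec.subspace_scale)
  qed
qed

lemma Hom_gtensorI:
  assumes Z: "subspaces Z" and f: "linear_on (total_space (X \<otimes>\<^sub>g Y)) f"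
    and s: "\<And>i j v w. i \<in> arr X \<Longrightarrow> j \<in> arr Y \<Longrightarrow> v \<in> fib X i \<Longrightarrow> w \<in> fib Y j \<Longrightarrow>
      f (gtens X Y (Poly_Mapping.single i v) (Poly_Mapping.single j w)) \<in> homogeneous Z (src X i) (tgt Y j)"
  shows "f \<in> Hom (X \<otimes>\<^sub>g Y) Z"
proof (rule HomI_singles[OF subspaces_gtensor Z f])
  fix k t assume k: "k \<in> arr (X \<otimes>\<^sub>g Y)" "t \<in> fib (X \<otimes>\<^sub>g Y) k"
  obtain i j where ij: "k = (i, j)" by fastforce
  have l: "linear_into (total_space (X \<otimes>\<^sub>g Y)) UNIV f"
    using f by (simp add: linear_into_def)
  have "Poly_Mapping.single (i, j) t \<in> {x \<in> total_space (X \<otimes>\<^sub>g Y). f x \<in> homogeneous Z (src X i) (tgt Y j)}"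
    by (rule single_gtensor_induct[OF k[unfolded ij]
          subspace_preimage[OF l subspace_total_space[OF subspaces_gtensor] subspace_homogeneous[OF Z]]])
      (use s in \<open>auto intro: gtens_in_total single_in_total\<close>)
  then show "f (Poly_Mapping.single k t) \<in> homogeneous Z (src (X \<otimes>\<^sub>g Y) k) (tgt (X \<otimes>\<^sub>g Y) k)"
    by (simp add: ij)
qed

text \<open>A map that preserves the degree \<open>\<beta> \<circ> \<alpha>\<close> preserves its source and target, which are those of
  the string. Strings in the image are composable, so this applies to them as well.\<close>

lemma End2_Hom:
  assumes G: "is_groupoid G" and V: "finite_type G V" and f: "f \<in> End2 G V"
  shows "f \<in> Hom (gr G V \<otimes>\<^sub>g gr G V) (gr G V \<otimes>\<^sub>g gr G V)" (is "f \<in> Hom ?Y ?Y")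
proof (rule HomI_singles[OF subspaces_gtensor subspaces_gtensor])
  show "linear_on (total_space ?Y) f"
    using f by (simp add: End2_def)
  fix k t assume k: "k \<in> arr ?Y" "t \<in> fib ?Y k"
  obtain \<alpha> \<beta> where ab: "k = (\<alpha>, \<beta>)" by fastforce
  have st: "src ?Y (\<gamma>, \<eta>) = src G (cmp G \<eta> \<gamma>) \<and> tgt ?Y (\<gamma>, \<eta>) = tgt G (cmp G \<eta> \<gamma>)"
    if "(\<gamma>, \<eta>) \<in> arr ?Y" for \<gamma> \<eta>
    using that G by (simp add: gtensor_def gr_def comp_arrows_def is_groupoid_def)
  let ?x = "Poly_Mapping.single k t"
  have x: "?x \<in> total_space ?Y"
    by (rule single_in_total[OF k])
  then have fx: "f ?x \<in> total_space ?Y"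
    using f by (auto simp: End2_def)
  have "\<forall>(\<gamma>, \<eta>)\<in>Poly_Mapping.keys ?x. cmp G \<eta> \<gamma> = cmp G \<beta> \<alpha>"
    by (auto simp: ab)
  then have deg: "\<forall>(\<gamma>, \<eta>)\<in>Poly_Mapping.keys (f ?x). cmp G \<eta> \<gamma> = cmp G \<beta> \<alpha>"
    using f x unfolding End2_def by blast
  have "src ?Y l = src ?Y k \<and> tgt ?Y l = tgt ?Y k" if l: "l \<in> Poly_Mapping.keys (f ?x)" for l
  proof -
    obtain \<gamma> \<eta> where l': "l = (\<gamma>, \<eta>)" by fastforce
    have "l \<in> arr ?Y" using fx l by (auto simp: total_space_def)
    moreover have "cmp G \<eta> \<gamma> = cmp G \<beta> \<alpha>" using deg l l' by auto
    ultimately show ?thesis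
      using st[of \<gamma> \<eta>] st[of \<alpha> \<beta>] k(1) unfolding l' ab by simp
  qed
  with fx show "f ?x \<in> homogeneous ?Y (src ?Y k) (tgt ?Y k)"
    by (simp add: homogeneous_def)
qed


section \<open>The structure maps act on generators\<close>

lemma linear_into_gtens_left:
  "y \<in> total_space Y \<Longrightarrow> linear_into (total_space X) (total_space (X \<otimes>\<^sub>g Y)) (\<lambda>x. gtens X Y x y)"
  by (auto simp: linear_into_def linear_on_def cbilinearD[OF cbilinear_gtens] gtens_in_total)

lemma linear_into_gtens_right:
  "x \<in> total_space X \<Longrightarrow> linear_into (total_space Y) (total_space (X \<otimes>\<^sub>g Y)) (gtens X Y x)"
  by (auto simp: linear_into_def linear_on_def cbilinearD[OF cbilinear_gtens] gtens_in_total)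

lemma map_gtensor_gtens:
  assumes "subspaces X" "subspaces Y" "f \<in> Hom X X'" "g \<in> Hom Y Y'" "x \<in> total_space X" "y \<in> total_space Y"
  shows "map_gtensor X Y X' Y' f g (gtens X Y x y) = gtens X' Y' (f x) (g y)"
  using map_gtensor[OF assms(1-4)] assms(5,6) by (simp add: is_map_gtensor_def)

lemma map_gtensor_Hom:
  assumes "subspaces X" "subspaces Y" "f \<in> Hom X X'" "g \<in> Hom Y Y'"
  shows "map_gtensor X Y X' Y' f g \<in> Hom (X \<otimes>\<^sub>g Y) (X' \<otimes>\<^sub>g Y')"
proof (rule Hom_gtensorI[OF subspaces_gtensor])
  show "linear_on (total_space (X \<otimes>\<^sub>g Y)) (map_gtensor X Y X' Y' f g)"
    using map_gtensor[OF assms] by (simp add: is_map_gtensor_def)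
  show "map_gtensor X Y X' Y' f g (gtens X Y (Poly_Mapping.single i v) (Poly_Mapping.single j w))
      \<in> homogeneous (X' \<otimes>\<^sub>g Y') (src X i) (tgt Y j)"
    if "i \<in> arr X" "j \<in> arr Y" "v \<in> fib X i" "w \<in> fib Y j" for i j v w
    using that by (simp add: map_gtensor_gtens[OF assms] single_in_total)
      (rule gtens_homogeneous[OF Hom_homogeneous[OF assms(3) single_homogeneous]
          Hom_homogeneous[OF assms(4) single_homogeneous]])
qed

lemma assoc_r_gtens:
  assumes "subspaces X" "subspaces Y" "subspaces Z" "x \<in> total_space X" "y \<in> total_space Y" "z \<in> total_space Z"
  shows "assoc_r X Y Z (gtens (X \<otimes>\<^sub>g Y) Z (gtens X Y x y) z) = gtens X (Y \<otimes>\<^sub>g Z) x (gtens Y Z y z)"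
  using assoc_r[OF assms(1-3)] assms(4-) by (simp add: is_assoc_r_def)

lemma assoc_l_gtens:
  assumes "subspaces X" "subspaces Y" "subspaces Z" "x \<in> total_space X" "y \<in> total_space Y" "z \<in> total_space Z"
  shows "assoc_l X Y Z (gtens X (Y \<otimes>\<^sub>g Z) x (gtens Y Z y z)) = gtens (X \<otimes>\<^sub>g Y) Z (gtens X Y x y) z"
  using assoc_l[OF assms(1-3)] assms(4-) by (simp add: is_assoc_l_def)

lemma assoc_r_Hom:
  assumes "subspaces X" "subspaces Y" "subspaces Z"
  shows "assoc_r X Y Z \<in> Hom ((X \<otimes>\<^sub>g Y) \<otimes>\<^sub>g Z) (X \<otimes>\<^sub>g (Y \<otimes>\<^sub>g Z))"
proof (rule Hom_gtensorI[OF subspaces_gtensor])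
  show l: "linear_on (total_space ((X \<otimes>\<^sub>g Y) \<otimes>\<^sub>g Z)) (assoc_r X Y Z)"
    using assoc_r[OF assms] by (simp add: is_assoc_r_def)
  fix k j t w assume k: "k \<in> arr (X \<otimes>\<^sub>g Y)" "j \<in> arr Z" "t \<in> fib (X \<otimes>\<^sub>g Y) k" "w \<in> fib Z j"
  obtain i i' where ij: "k = (i, i')" by fastforce
  let ?w = "Poly_Mapping.single j w"
  have w: "?w \<in> total_space Z" using k by (simp add: single_in_total)
  have li: "linear_into (total_space (X \<otimes>\<^sub>g Y)) UNIV (\<lambda>p. assoc_r X Y Z (gtens (X \<otimes>\<^sub>g Y) Z p ?w))"
    by (rule linear_into_comp[OF linear_into_gtens_left[OF w]]) (use l in \<open>simp add: linear_into_def\<close>)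
  have "Poly_Mapping.single (i, i') t \<in> {p \<in> total_space (X \<otimes>\<^sub>g Y).
      assoc_r X Y Z (gtens (X \<otimes>\<^sub>g Y) Z p ?w) \<in> homogeneous (X \<otimes>\<^sub>g (Y \<otimes>\<^sub>g Z)) (src X i) (tgt Z j)}"
  proof (rule single_gtensor_induct[OF k(1,3)[unfolded ij] subspace_preimage[OF li
          subspace_total_space[OF subspaces_gtensor] subspace_homogeneous[OF subspaces_gtensor]]])
    fix u v assume uv: "i \<in> arr X" "i' \<in> arr Y" "u \<in> fib X i" "v \<in> fib Y i'"
    have "gtens X (Y \<otimes>\<^sub>g Z) (Poly_Mapping.single i u) (gtens Y Z (Poly_Mapping.single i' v) ?w)
        \<in> homogeneous (X \<otimes>\<^sub>g (Y \<otimes>\<^sub>g Z)) (src X i) (tgt Z j)"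
      by (rule gtens_homogeneous single_homogeneous uv k)+
    then show "gtens X Y (Poly_Mapping.single i u) (Poly_Mapping.single i' v) \<in> {p \<in> total_space (X \<otimes>\<^sub>g Y).
      assoc_r X Y Z (gtens (X \<otimes>\<^sub>g Y) Z p ?w) \<in> homogeneous (X \<otimes>\<^sub>g (Y \<otimes>\<^sub>g Z)) (src X i) (tgt Z j)}"
      using uv w by (simp add: gtens_in_total single_in_total assoc_r_gtens[OF assms])
  qed
  then show "assoc_r X Y Z (gtens (X \<otimes>\<^sub>g Y) Z (Poly_Mapping.single k t) ?w)
      \<in> homogeneous (X \<otimes>\<^sub>g (Y \<otimes>\<^sub>g Z)) (src (X \<otimes>\<^sub>g Y) k) (tgt Z j)"
    by (simp add: ij)
qed

lemma assoc_l_Hom: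
  assumes "subspaces X" "subspaces Y" "subspaces Z"
  shows "assoc_l X Y Z \<in> Hom (X \<otimes>\<^sub>g (Y \<otimes>\<^sub>g Z)) ((X \<otimes>\<^sub>g Y) \<otimes>\<^sub>g Z)"
proof (rule Hom_gtensorI[OF subspaces_gtensor])
  show l: "linear_on (total_space (X \<otimes>\<^sub>g (Y \<otimes>\<^sub>g Z))) (assoc_l X Y Z)"
    using assoc_l[OF assms] by (simp add: is_assoc_l_def)
  fix i k u t assume k: "i \<in> arr X" "k \<in> arr (Y \<otimes>\<^sub>g Z)" "u \<in> fib X i" "t \<in> fib (Y \<otimes>\<^sub>g Z) k"
  obtain j j' where ij: "k = (j, j')" by fastforce
  let ?u = "Poly_Mapping.single i u"
  have u: "?u \<in> total_space X" using k by (simp add: single_in_total)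
  have li: "linear_into (total_space (Y \<otimes>\<^sub>g Z)) UNIV (\<lambda>p. assoc_l X Y Z (gtens X (Y \<otimes>\<^sub>g Z) ?u p))"
    by (rule linear_into_comp[OF linear_into_gtens_right[OF u]]) (use l in \<open>simp add: linear_into_def\<close>)
  have "Poly_Mapping.single (j, j') t \<in> {p \<in> total_space (Y \<otimes>\<^sub>g Z).
      assoc_l X Y Z (gtens X (Y \<otimes>\<^sub>g Z) ?u p) \<in> homogeneous ((X \<otimes>\<^sub>g Y) \<otimes>\<^sub>g Z) (src X i) (tgt Z j')}"
  proof (rule single_gtensor_induct[OF k(2,4)[unfolded ij] subspace_preimage[OF li
          subspace_total_space[OF subspaces_gtensor] subspace_homogeneous[OF subspaces_gtensor]]])
    fix v w assume uv: "j \<in> arr Y" "j' \<in> arr Z" "v \<in> fib Y j" "w \<in> fib Z j'"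
    have "gtens (X \<otimes>\<^sub>g Y) Z (gtens X Y ?u (Poly_Mapping.single j v)) (Poly_Mapping.single j' w)
        \<in> homogeneous ((X \<otimes>\<^sub>g Y) \<otimes>\<^sub>g Z) (src X i) (tgt Z j')"
      by (rule gtens_homogeneous single_homogeneous uv k)+
    then show "gtens Y Z (Poly_Mapping.single j v) (Poly_Mapping.single j' w) \<in> {p \<in> total_space (Y \<otimes>\<^sub>g Z).
      assoc_l X Y Z (gtens X (Y \<otimes>\<^sub>g Z) ?u p) \<in> homogeneous ((X \<otimes>\<^sub>g Y) \<otimes>\<^sub>g Z) (src X i) (tgt Z j')}"
      using uv u by (simp add: gtens_in_total single_in_total assoc_l_gtens[OF assms])
  qed
  then show "assoc_l X Y Z (gtens X (Y \<otimes>\<^sub>g Z) ?u (Poly_Mapping.single k t))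
      \<in> homogeneous ((X \<otimes>\<^sub>g Y) \<otimes>\<^sub>g Z) (src X i) (tgt (Y \<otimes>\<^sub>g Z) k)"
    by (simp add: ij)
qed

lemma assoc_l_assoc_r:
  assumes s: "subspaces X" "subspaces Y" "subspaces Z" and t: "t \<in> total_space ((X \<otimes>\<^sub>g Y) \<otimes>\<^sub>g Z)"
  shows "assoc_l X Y Z (assoc_r X Y Z t) = t"
proof -
  note T = total_gtensor_gtensor_l[OF s]
  have "linear_into (total_space ((X \<otimes>\<^sub>g Y) \<otimes>\<^sub>g Z)) (total_space ((X \<otimes>\<^sub>g Y) \<otimes>\<^sub>g Z)) (\<lambda>t. assoc_l X Y Z (assoc_r X Y Z t))"
    by (rule linear_into_comp[OF Hom_linear_into[OF assoc_r_Hom[OF s]] Hom_linear_into[OF assoc_l_Hom[OF s]]])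
  from linear_into_eq_on_span[OF this[unfolded T] Hom_linear_into[OF id_Hom, where X = "(X \<otimes>\<^sub>g Y) \<otimes>\<^sub>g Z", unfolded T] _ t[unfolded T]]
  show ?thesis
    by (force simp: assoc_r_gtens[OF s] assoc_l_gtens[OF s])
qed

lemma assoc_r_assoc_l:
  assumes s: "subspaces X" "subspaces Y" "subspaces Z" and t: "t \<in> total_space (X \<otimes>\<^sub>g (Y \<otimes>\<^sub>g Z))"
  shows "assoc_r X Y Z (assoc_l X Y Z t) = t"
proof -
  note T = total_gtensor_gtensor_r[OF s]
  have "linear_into (total_space (X \<otimes>\<^sub>g (Y \<otimes>\<^sub>g Z))) (total_space (X \<otimes>\<^sub>g (Y \<otimes>\<^sub>g Z))) (\<lambda>t. assoc_r X Y Z (assoc_l X Y Z t))"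
    by (rule linear_into_comp[OF Hom_linear_into[OF assoc_l_Hom[OF s]] Hom_linear_into[OF assoc_r_Hom[OF s]]])
  from linear_into_eq_on_span[OF this[unfolded T] Hom_linear_into[OF id_Hom, where X = "X \<otimes>\<^sub>g (Y \<otimes>\<^sub>g Z)", unfolded T] _ t[unfolded T]]
  show ?thesis
    by (force simp: assoc_r_gtens[OF s] assoc_l_gtens[OF s])
qed

lemma tail_Hom:
  assumes "subspaces X" "subspaces Y" "f \<in> Hom Y Y'"
  shows "tail X Y Y' f \<in> Hom (X \<otimes>\<^sub>g Y) (X \<otimes>\<^sub>g Y')"
  unfolding tail_def by (rule map_gtensor_Hom[OF assms(1,2) id_Hom assms(3)])

lemma tail_gtens:
  assumes "subspaces X" "subspaces Y" "f \<in> Hom Y Y'" "x \<in> total_space X" "y \<in> total_space Y"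
  shows "tail X Y Y' f (gtens X Y x y) = gtens X Y' x (f y)"
  unfolding tail_def using map_gtensor_gtens[OF assms(1,2) id_Hom assms(3-)] by simp

lemma head_Hom:
  assumes "subspaces X" "subspaces Y" "subspaces X'" "subspaces Y'" "subspaces Z"
    and "f \<in> Hom (X \<otimes>\<^sub>g Y) (X' \<otimes>\<^sub>g Y')"
  shows "head X Y X' Y' Z f \<in> Hom (X \<otimes>\<^sub>g (Y \<otimes>\<^sub>g Z)) (X' \<otimes>\<^sub>g (Y' \<otimes>\<^sub>g Z))"
  unfolding head_def
  by (rule Hom_comp map_gtensor_Hom assoc_l_Hom assoc_r_Hom id_Hom subspaces_gtensor assms)+

text \<open>\<open>p \<otimes> w\<close>, rebracketed to the right. If \<open>p\<close> ranges over all of \<open>X \<otimes> Y\<close>, and not only over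
  elementary tensors, these generators make the action of \<open>head\<close> visible: by \<open>head_snoc\<close> it
  simply replaces \<open>p\<close> by \<open>f p\<close>, which need not be elementary.\<close>

definition snoc where
  "snoc X Y Z p w = assoc_r X Y Z (gtens (X \<otimes>\<^sub>g Y) Z p w)"

lemma snoc_gtens:
  assumes "subspaces X" "subspaces Y" "subspaces Z" "x \<in> total_space X" "y \<in> total_space Y" "z \<in> total_space Z"
  shows "snoc X Y Z (gtens X Y x y) z = gtens X (Y \<otimes>\<^sub>g Z) x (gtens Y Z y z)"
  unfolding snoc_def by (rule assoc_r_gtens[OF assms])

lemma linear_into_snoc_left:
  assumes "subspaces X" "subspaces Y" "subspaces Z" "w \<in> total_space Z"
  shows "linear_into (total_space (X \<otimes>\<^sub>g Y)) (total_space (X \<otimes>\<^sub>g (Y \<otimes>\<^sub>g Z))) (\<lambda>p. snoc X Y Z p w)"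
  unfolding snoc_def
  by (rule linear_into_comp[OF linear_into_gtens_left[OF assms(4)] Hom_linear_into[OF assoc_r_Hom[OF assms(1-3)]]])

lemma linear_into_snoc_right:
  assumes "subspaces X" "subspaces Y" "subspaces Z" "p \<in> total_space (X \<otimes>\<^sub>g Y)"
  shows "linear_into (total_space Z) (total_space (X \<otimes>\<^sub>g (Y \<otimes>\<^sub>g Z))) (snoc X Y Z p)"
  unfolding snoc_def
  by (rule linear_into_comp[OF linear_into_gtens_right[OF assms(4)] Hom_linear_into[OF assoc_r_Hom[OF assms(1-3)]]])

lemma snoc_in_total:
  assumes "subspaces X" "subspaces Y" "subspaces Z" "p \<in> total_space (X \<otimes>\<^sub>g Y)" "w \<in> total_space Z"
  shows "snoc X Y Z p w \<in> total_space (X \<otimes>\<^sub>g (Y \<otimes>\<^sub>g Z))"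
  by (rule linear_into_mem[OF linear_into_snoc_right[OF assms(1-4)] assms(5)])

lemma total_snoc:
  assumes s: "subspaces X" "subspaces Y" "subspaces Z"
  shows "total_space (X \<otimes>\<^sub>g (Y \<otimes>\<^sub>g Z)) =
    cvec.span {snoc X Y Z p w | p w. p \<in> total_space (X \<otimes>\<^sub>g Y) \<and> w \<in> total_space Z}" (is "_ = cvec.span ?G")
proof
  show "cvec.span ?G \<subseteq> total_space (X \<otimes>\<^sub>g (Y \<otimes>\<^sub>g Z))"
    by (rule cvec.span_minimal) (auto intro: snoc_in_total s subspace_total_space subspaces_gtensor)
  show "total_space (X \<otimes>\<^sub>g (Y \<otimes>\<^sub>g Z)) \<subseteq> cvec.span ?G"
    unfolding total_gtensor_gtensor_r[OF s]
  proof (rule cvec.span_mono, clarify)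
    fix x y z assume "x \<in> total_space X" "y \<in> total_space Y" "z \<in> total_space Z"
    then show "\<exists>p w. gtens X (Y \<otimes>\<^sub>g Z) x (gtens Y Z y z) = snoc X Y Z p w \<and>
        p \<in> total_space (X \<otimes>\<^sub>g Y) \<and> w \<in> total_space Z"
      using snoc_gtens[OF s] gtens_in_total by metis
  qed
qed

lemma head_snoc:
  assumes s: "subspaces X" "subspaces Y" "subspaces Z" and f: "f \<in> Hom (X \<otimes>\<^sub>g Y) (X' \<otimes>\<^sub>g Y')"
    and p: "p \<in> total_space (X \<otimes>\<^sub>g Y)" and w: "w \<in> total_space Z"
  shows "head X Y X' Y' Z f (snoc X Y Z p w) = snoc X' Y' Z (f p) w"
  using map_gtensor_gtens[OF subspaces_gtensor s(3) f id_Hom p w] assoc_l_assoc_r[OF s gtens_in_total[OF p w]]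
  by (simp add: head_def snoc_def)

lemma tail_tail_snoc:
  assumes s: "subspaces X" "subspaces Y" "subspaces Z" "subspaces Z'" and g: "g \<in> Hom Z Z'"
    and p: "p \<in> total_space (X \<otimes>\<^sub>g Y)" and w: "w \<in> total_space Z"
  shows "tail X (Y \<otimes>\<^sub>g Z) (Y \<otimes>\<^sub>g Z') (tail Y Z Z' g) (snoc X Y Z p w) = snoc X Y Z' p (g w)"
proof -
  note T = total_gtensor[OF s(1,2)]
  have t: "tail Y Z Z' g \<in> Hom (Y \<otimes>\<^sub>g Z) (Y \<otimes>\<^sub>g Z')"
    by (rule tail_Hom[OF s(2,3) g])
  have gw: "g w \<in> total_space Z'" by (rule Hom_mem[OF g w])
  show ?thesis
  proof (rule linear_into_eq_on_span[OF
        linear_into_comp[OF linear_into_snoc_left[OF s(1-3) w] Hom_linear_into[OF tail_Hom[OF s(1) subspaces_gtensor t]], unfolded T]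
        linear_into_snoc_left[OF s(1,2,4) gw, unfolded T] _ p[unfolded T]])
    show "tail X (Y \<otimes>\<^sub>g Z) (Y \<otimes>\<^sub>g Z') (tail Y Z Z' g) (snoc X Y Z p w) = snoc X Y Z' p (g w)"
      if "p \<in> {gtens X Y x y | x y. x \<in> total_space X \<and> y \<in> total_space Y}" for p
      using that w gw
      by (auto simp: snoc_gtens s tail_gtens[OF s(1) subspaces_gtensor t] tail_gtens[OF s(2,3) g] gtens_in_total)
  qed
qed

text \<open>Both sides send \<open>snoc p w\<close> to \<open>snoc (f p) (g w)\<close>.\<close>

lemma head_tail_commute:
  assumes s: "subspaces X" "subspaces Y" "subspaces X'" "subspaces Y'" "subspaces Z" "subspaces Z'"
    and f: "f \<in> Hom (X \<otimes>\<^sub>g Y) (X' \<otimes>\<^sub>g Y')" and g: "g \<in> Hom Z Z'"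
    and x: "x \<in> total_space (X \<otimes>\<^sub>g (Y \<otimes>\<^sub>g Z))"
  shows "head X Y X' Y' Z' f (tail X (Y \<otimes>\<^sub>g Z) (Y \<otimes>\<^sub>g Z') (tail Y Z Z' g) x) =
    tail X' (Y' \<otimes>\<^sub>g Z) (Y' \<otimes>\<^sub>g Z') (tail Y' Z Z' g) (head X Y X' Y' Z f x)"
proof -
  note T = total_snoc[OF s(1,2,5)]
  have 1: "head X Y X' Y' Z' f \<circ> tail X (Y \<otimes>\<^sub>g Z) (Y \<otimes>\<^sub>g Z') (tail Y Z Z' g)
      \<in> Hom (X \<otimes>\<^sub>g (Y \<otimes>\<^sub>g Z)) (X' \<otimes>\<^sub>g (Y' \<otimes>\<^sub>g Z'))"
    by (rule Hom_comp tail_Hom head_Hom subspaces_gtensor s f g)+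
  have 2: "tail X' (Y' \<otimes>\<^sub>g Z) (Y' \<otimes>\<^sub>g Z') (tail Y' Z Z' g) \<circ> head X Y X' Y' Z f
      \<in> Hom (X \<otimes>\<^sub>g (Y \<otimes>\<^sub>g Z)) (X' \<otimes>\<^sub>g (Y' \<otimes>\<^sub>g Z'))"
    by (rule Hom_comp tail_Hom head_Hom subspaces_gtensor s f g)+
  have "(head X Y X' Y' Z' f \<circ> tail X (Y \<otimes>\<^sub>g Z) (Y \<otimes>\<^sub>g Z') (tail Y Z Z' g)) x =
      (tail X' (Y' \<otimes>\<^sub>g Z) (Y' \<otimes>\<^sub>g Z') (tail Y' Z Z' g) \<circ> head X Y X' Y' Z f) x"
    by (rule linear_into_eq_on_span[OF Hom_linear_into[OF 1, unfolded T] Hom_linear_into[OF 2, unfolded T] _ x[unfolded T]])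
      (auto simp: tail_tail_snoc[OF s(1,2,5,6) g] tail_tail_snoc[OF s(3-6) g]
        head_snoc[OF s(1,2,5) f] head_snoc[OF s(1,2,6) f] Hom_mem[OF f] Hom_mem[OF g])
  then show ?thesis by simp
qed

text \<open>\<open>t \<otimes> w\<close> for \<open>t \<in> X \<otimes> (Y \<otimes> Z)\<close>, rebracketed to the right: a further factor is carried along as
  a spectator of an operator on three factors.\<close>

definition snoc2 where
  "snoc2 X Y Z W t w = tail X ((Y \<otimes>\<^sub>g Z) \<otimes>\<^sub>g W) (Y \<otimes>\<^sub>g (Z \<otimes>\<^sub>g W)) (assoc_r Y Z W) (snoc X (Y \<otimes>\<^sub>g Z) W t w)"

lemma snoc2_gtens:
  assumes s: "subspaces X" "subspaces Y" "subspaces Z" "subspaces W"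
    and "x \<in> total_space X" "t \<in> total_space (Y \<otimes>\<^sub>g Z)" "w \<in> total_space W"
  shows "snoc2 X Y Z W (gtens X (Y \<otimes>\<^sub>g Z) x t) w = gtens X (Y \<otimes>\<^sub>g (Z \<otimes>\<^sub>g W)) x (snoc Y Z W t w)"
  using assms(5-)
  by (simp add: snoc2_def snoc_gtens s subspaces_gtensor tail_gtens[OF s(1) subspaces_gtensor assoc_r_Hom[OF s(2-4)]]
      gtens_in_total snoc_def[of Y Z W])

lemma linear_into_snoc2:
  assumes s: "subspaces X" "subspaces Y" "subspaces Z" "subspaces W" and w: "w \<in> total_space W"
  shows "linear_into (total_space (X \<otimes>\<^sub>g (Y \<otimes>\<^sub>g Z))) (total_space (X \<otimes>\<^sub>g (Y \<otimes>\<^sub>g (Z \<otimes>\<^sub>g W)))) (\<lambda>t. snoc2 X Y Z W t w)"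
  unfolding snoc2_def
  by (rule linear_into_comp[OF linear_into_snoc_left[OF s(1) subspaces_gtensor s(4) w]
        Hom_linear_into[OF tail_Hom[OF s(1) subspaces_gtensor assoc_r_Hom[OF s(2-4)]]]])

text \<open>This is the pentagon identity: two ways to rebracket \<open>((X \<otimes> Y) \<otimes> Z) \<otimes> W\<close> to the right.\<close>

lemma snoc2_snoc:
  assumes s: "subspaces X" "subspaces Y" "subspaces Z" "subspaces W"
    and p: "p \<in> total_space (X \<otimes>\<^sub>g Y)" and z: "z \<in> total_space Z" and w: "w \<in> total_space W"
  shows "snoc2 X Y Z W (snoc X Y Z p z) w = snoc X Y (Z \<otimes>\<^sub>g W) p (gtens Z W z w)"
proof -
  note T = total_gtensor[OF s(1,2)]
  have zw: "gtens Z W z w \<in> total_space (Z \<otimes>\<^sub>g W)" by (rule gtens_in_total[OF z w])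
  show ?thesis
  proof (rule linear_into_eq_on_span[OF
        linear_into_comp[OF linear_into_snoc_left[OF s(1-3) z] linear_into_snoc2[OF s w], unfolded T]
        linear_into_snoc_left[OF s(1,2) subspaces_gtensor zw, unfolded T] _ p[unfolded T]])
    show "snoc2 X Y Z W (snoc X Y Z p z) w = snoc X Y (Z \<otimes>\<^sub>g W) p (gtens Z W z w)"
      if "p \<in> {gtens X Y x y | x y. x \<in> total_space X \<and> y \<in> total_space Y}" for p
      using that z w zw
      by (auto simp: snoc_gtens s subspaces_gtensor snoc2_gtens gtens_in_total)
  qed
qed

lemma total_snoc2:
  assumes s: "subspaces X" "subspaces Y" "subspaces Z" "subspaces W"
  shows "total_space (X \<otimes>\<^sub>g (Y \<otimes>\<^sub>g (Z \<otimes>\<^sub>g W))) =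
    cvec.span {snoc2 X Y Z W t w | t w. t \<in> total_space (X \<otimes>\<^sub>g (Y \<otimes>\<^sub>g Z)) \<and> w \<in> total_space W}" (is "?T = cvec.span ?G")
proof
  show "cvec.span ?G \<subseteq> ?T"
    by (rule cvec.span_minimal)
      (auto intro: linear_into_mem[OF linear_into_snoc2[OF s]] subspace_total_space subspaces_gtensor)
  have "gtens X (Y \<otimes>\<^sub>g (Z \<otimes>\<^sub>g W)) x u \<in> cvec.span ?G"
    if x: "x \<in> total_space X" and u: "u \<in> total_space (Y \<otimes>\<^sub>g (Z \<otimes>\<^sub>g W))" for x u
  proof -
    have "total_space (Y \<otimes>\<^sub>g (Z \<otimes>\<^sub>g W)) \<subseteq> {u \<in> total_space (Y \<otimes>\<^sub>g (Z \<otimes>\<^sub>g W)). gtens X (Y \<otimes>\<^sub>g (Z \<otimes>\<^sub>g W)) x u \<in> cvec.span ?G}"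
      unfolding total_snoc[OF s(2-4)]
    proof (rule cvec.span_minimal[OF _ subspace_preimage[OF linear_into_gtens_right[OF x, where Y = "Y \<otimes>\<^sub>g (Z \<otimes>\<^sub>g W)"], unfolded total_snoc[OF s(2-4)]]])
      show "{snoc Y Z W t w | t w. t \<in> total_space (Y \<otimes>\<^sub>g Z) \<and> w \<in> total_space W} \<subseteq>
        {u \<in> cvec.span {snoc Y Z W t w | t w. t \<in> total_space (Y \<otimes>\<^sub>g Z) \<and> w \<in> total_space W}.
          gtens X (Y \<otimes>\<^sub>g (Z \<otimes>\<^sub>g W)) x u \<in> cvec.span ?G}"
      proof (clarify, intro CollectI conjI cvec.span_base)
        fix t w assume "t \<in> total_space (Y \<otimes>\<^sub>g Z)" "w \<in> total_space W"
        then show "\<exists>t' w'. gtens X (Y \<otimes>\<^sub>g (Z \<otimes>\<^sub>g W)) x (snoc Y Z W t w) = snoc2 X Y Z W t' w' \<and>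
            t' \<in> total_space (X \<otimes>\<^sub>g (Y \<otimes>\<^sub>g Z)) \<and> w' \<in> total_space W"
          using snoc2_gtens[OF s x] gtens_in_total[OF x] by metis
      qed blast
    qed simp_all
    with u show ?thesis by blast
  qed
  then show "?T \<subseteq> cvec.span ?G"
    unfolding total_gtensor[OF s(1) subspaces_gtensor] by (intro cvec.span_minimal) auto
qed

text \<open>Every \<open>t\<close> is a sum of terms \<open>snoc p z\<close>. For these, \<open>snoc2_snoc\<close> exposes \<open>p\<close>, on which alone \<open>f\<close>
  acts.\<close>

lemma head_snoc2:
  assumes s: "subspaces X" "subspaces Y" "subspaces X'" "subspaces Y'" "subspaces Z" "subspaces W"
    and f: "f \<in> Hom (X \<otimes>\<^sub>g Y) (X' \<otimes>\<^sub>g Y')"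
    and t: "t \<in> total_space (X \<otimes>\<^sub>g (Y \<otimes>\<^sub>g Z))" and w: "w \<in> total_space W"
  shows "head X Y X' Y' (Z \<otimes>\<^sub>g W) f (snoc2 X Y Z W t w) = snoc2 X' Y' Z W (head X Y X' Y' Z f t) w"
proof -
  note T = total_snoc[OF s(1,2,5)]
  have 1: "head X Y X' Y' (Z \<otimes>\<^sub>g W) f \<in> Hom (X \<otimes>\<^sub>g (Y \<otimes>\<^sub>g (Z \<otimes>\<^sub>g W))) (X' \<otimes>\<^sub>g (Y' \<otimes>\<^sub>g (Z \<otimes>\<^sub>g W)))"
    and 2: "head X Y X' Y' Z f \<in> Hom (X \<otimes>\<^sub>g (Y \<otimes>\<^sub>g Z)) (X' \<otimes>\<^sub>g (Y' \<otimes>\<^sub>g Z))"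
    by (rule head_Hom subspaces_gtensor s f)+
  show ?thesis
  proof (rule linear_into_eq_on_span[OF
        linear_into_comp[OF linear_into_snoc2[OF s(1,2,5,6) w] Hom_linear_into[OF 1], unfolded T]
        linear_into_comp[OF Hom_linear_into[OF 2] linear_into_snoc2[OF s(3-6) w], unfolded T] _ t[unfolded T]])
    show "head X Y X' Y' (Z \<otimes>\<^sub>g W) f (snoc2 X Y Z W t w) = snoc2 X' Y' Z W (head X Y X' Y' Z f t) w"
      if "t \<in> {snoc X Y Z p z | p z. p \<in> total_space (X \<otimes>\<^sub>g Y) \<and> z \<in> total_space Z}" for t
      using that w
      by (auto simp: snoc2_snoc s head_snoc[OF s(1,2) _ f] subspaces_gtensor gtens_in_total Hom_mem[OF f])
  qed
qed

lemma tail_head_snoc2: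
  assumes s: "subspaces X" "subspaces Y" "subspaces Z" "subspaces Y'" "subspaces Z'" "subspaces W"
    and f: "f \<in> Hom (Y \<otimes>\<^sub>g Z) (Y' \<otimes>\<^sub>g Z')"
    and t: "t \<in> total_space (X \<otimes>\<^sub>g (Y \<otimes>\<^sub>g Z))" and w: "w \<in> total_space W"
  shows "tail X (Y \<otimes>\<^sub>g (Z \<otimes>\<^sub>g W)) (Y' \<otimes>\<^sub>g (Z' \<otimes>\<^sub>g W)) (head Y Z Y' Z' W f) (snoc2 X Y Z W t w) =
    snoc2 X Y' Z' W (tail X (Y \<otimes>\<^sub>g Z) (Y' \<otimes>\<^sub>g Z') f t) w"
proof -
  note T = total_gtensor[OF s(1) subspaces_gtensor]
  have h: "head Y Z Y' Z' W f \<in> Hom (Y \<otimes>\<^sub>g (Z \<otimes>\<^sub>g W)) (Y' \<otimes>\<^sub>g (Z' \<otimes>\<^sub>g W))"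
    by (rule head_Hom subspaces_gtensor s f)+
  show ?thesis
  proof (rule linear_into_eq_on_span[OF
        linear_into_comp[OF linear_into_snoc2[OF s(1-3,6) w] Hom_linear_into[OF tail_Hom[OF s(1) subspaces_gtensor h]], unfolded T]
        linear_into_comp[OF Hom_linear_into[OF tail_Hom[OF s(1) subspaces_gtensor f]] linear_into_snoc2[OF s(1,4-6) w], unfolded T]
        _ t[unfolded T]])
    show "tail X (Y \<otimes>\<^sub>g (Z \<otimes>\<^sub>g W)) (Y' \<otimes>\<^sub>g (Z' \<otimes>\<^sub>g W)) (head Y Z Y' Z' W f) (snoc2 X Y Z W t w) =
        snoc2 X Y' Z' W (tail X (Y \<otimes>\<^sub>g Z) (Y' \<otimes>\<^sub>g Z') f t) w"
      if "t \<in> {gtens X (Y \<otimes>\<^sub>g Z) x u | x u. x \<in> total_space X \<and> u \<in> total_space (Y \<otimes>\<^sub>g Z)}" for t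
      using that w
      by (auto simp: snoc2_gtens s head_snoc[OF s(2,3,6) f] snoc_in_total tail_gtens[OF s(1) subspaces_gtensor h]
          tail_gtens[OF s(1) subspaces_gtensor f] Hom_mem[OF f])
  qed
qed

section \<open>Intertwining relations with spectator factors\<close>

text \<open>On \<open>snoc2 t w\<close> every operator involved acts on \<open>t\<close> only, so the relation at \<open>t\<close> gives the one at
  \<open>snoc2 t w\<close>, with the same exceptional set.\<close>

lemma relation_tensor_spectator_right:
  assumes s: "subspaces X" "subspaces Y" "subspaces M" "subspaces N"
    and C: "C \<in> Hom (X \<otimes>\<^sub>g M) (M \<otimes>\<^sub>g Y)"
    and R: "\<And>z. R z \<in> Hom (X \<otimes>\<^sub>g X) (X \<otimes>\<^sub>g X)" and S: "\<And>z. S z \<in> Hom (Y \<otimes>\<^sub>g Y) (Y \<otimes>\<^sub>g Y)"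
    and rel: "\<And>t. t \<in> total_space (X \<otimes>\<^sub>g (X \<otimes>\<^sub>g M)) \<Longrightarrow> \<forall>\<^sub>F z in F.
      head X M M Y Y C (tail X (X \<otimes>\<^sub>g M) (M \<otimes>\<^sub>g Y) C (head X X X X M (R z) t)) =
      tail M (Y \<otimes>\<^sub>g Y) (Y \<otimes>\<^sub>g Y) (S z) (head X M M Y Y C (tail X (X \<otimes>\<^sub>g M) (M \<otimes>\<^sub>g Y) C t))"
    and x: "x \<in> total_space (X \<otimes>\<^sub>g (X \<otimes>\<^sub>g (M \<otimes>\<^sub>g N)))"
  defines "K \<equiv> head X M M Y (Y \<otimes>\<^sub>g N) C \<circ>
      tail X (X \<otimes>\<^sub>g (M \<otimes>\<^sub>g N)) (M \<otimes>\<^sub>g (Y \<otimes>\<^sub>g N)) (head X M M Y N C)"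
  shows "\<forall>\<^sub>F z in F. K (head X X X X (M \<otimes>\<^sub>g N) (R z) x) =
    tail M (Y \<otimes>\<^sub>g (Y \<otimes>\<^sub>g N)) (Y \<otimes>\<^sub>g (Y \<otimes>\<^sub>g N)) (head Y Y Y Y N (S z)) (K x)"
proof -
  let ?XXMN = "X \<otimes>\<^sub>g (X \<otimes>\<^sub>g (M \<otimes>\<^sub>g N))" and ?MYYN = "M \<otimes>\<^sub>g (Y \<otimes>\<^sub>g (Y \<otimes>\<^sub>g N))"
  define K0 where "K0 = head X M M Y Y C \<circ> tail X (X \<otimes>\<^sub>g M) (M \<otimes>\<^sub>g Y) C"
  note T = total_snoc2[OF s(1,1,3,4)]
  note Hr = Hom_comp tail_Hom head_Hom subspaces_gtensor s C R S
  have K: "K \<in> Hom ?XXMN ?MYYN"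
    unfolding K_def by (rule Hr)+
  have K0: "K0 \<in> Hom (X \<otimes>\<^sub>g (X \<otimes>\<^sub>g M)) (M \<otimes>\<^sub>g (Y \<otimes>\<^sub>g Y))"
    unfolding K0_def by (rule Hr)+
  have R12: "head X X X X M (R z) \<in> Hom (X \<otimes>\<^sub>g (X \<otimes>\<^sub>g M)) (X \<otimes>\<^sub>g (X \<otimes>\<^sub>g M))" for z
    by (rule Hr)+
  have C23: "tail X (X \<otimes>\<^sub>g M) (M \<otimes>\<^sub>g Y) C \<in> Hom (X \<otimes>\<^sub>g (X \<otimes>\<^sub>g M)) (X \<otimes>\<^sub>g (M \<otimes>\<^sub>g Y))"
    by (rule Hr)+
  have l: "K \<circ> head X X X X (M \<otimes>\<^sub>g N) (R z) \<in> Hom ?XXMN ?MYYN"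
    and r: "tail M (Y \<otimes>\<^sub>g (Y \<otimes>\<^sub>g N)) (Y \<otimes>\<^sub>g (Y \<otimes>\<^sub>g N)) (head Y Y Y Y N (S z)) \<circ> K \<in> Hom ?XXMN ?MYYN" for z
    by (rule Hr K)+
  have Ks: "K (snoc2 X X M N t w) = snoc2 M Y Y N (K0 t) w"
    if "t \<in> total_space (X \<otimes>\<^sub>g (X \<otimes>\<^sub>g M))" "w \<in> total_space N" for t w
    using that Hom_mem[OF C23 that(1)]
    by (simp add: K_def K0_def tail_head_snoc2[OF s(1,1,3,3,2,4) C] head_snoc2[OF s(1,3,3,2,2,4) C])
  have "\<forall>\<^sub>F z in F. (K \<circ> head X X X X (M \<otimes>\<^sub>g N) (R z)) x =
    (tail M (Y \<otimes>\<^sub>g (Y \<otimes>\<^sub>g N)) (Y \<otimes>\<^sub>g (Y \<otimes>\<^sub>g N)) (head Y Y Y Y N (S z)) \<circ> K) x"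
  proof (rule eventually_eq_on_span[OF Hom_linear_into[OF l, unfolded T] Hom_linear_into[OF r, unfolded T] _ x[unfolded T]])
    fix u assume "u \<in> {snoc2 X X M N t w | t w. t \<in> total_space (X \<otimes>\<^sub>g (X \<otimes>\<^sub>g M)) \<and> w \<in> total_space N}"
    then obtain t w where u: "u = snoc2 X X M N t w" and t: "t \<in> total_space (X \<otimes>\<^sub>g (X \<otimes>\<^sub>g M))" and w: "w \<in> total_space N"
      by blast
    from rel[OF t] show "\<forall>\<^sub>F z in F. (K \<circ> head X X X X (M \<otimes>\<^sub>g N) (R z)) u =
        (tail M (Y \<otimes>\<^sub>g (Y \<otimes>\<^sub>g N)) (Y \<otimes>\<^sub>g (Y \<otimes>\<^sub>g N)) (head Y Y Y Y N (S z)) \<circ> K) u"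
    proof eventually_elim
      case (elim z)
      then have "K0 (head X X X X M (R z) t) = tail M (Y \<otimes>\<^sub>g Y) (Y \<otimes>\<^sub>g Y) (S z) (K0 t)"
        by (simp add: K0_def)
      then show ?case
        by (simp add: u Ks t w head_snoc2[OF s(1,1,1,1,3,4) R] Hom_mem[OF R12] Hom_mem[OF K0]
            tail_head_snoc2[OF s(3,2,2,2,2,4) S])
    qed
  qed
  then show ?thesis by simp
qed

lemma relation_tensor_spectator_left:
  assumes s: "subspaces M" "subspaces A" "subspaces B"
    and f: "\<And>z. f z \<in> Hom A B" and g: "\<And>z. g z \<in> Hom A B"
    and rel: "\<And>t. t \<in> total_space A \<Longrightarrow> \<forall>\<^sub>F z in F. f z t = g z t"
    and x: "x \<in> total_space (M \<otimes>\<^sub>g A)"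
  shows "\<forall>\<^sub>F z in F. tail M A B (f z) x = tail M A B (g z) x"
proof -
  note T = total_gtensor[OF s(1,2)]
  show ?thesis
  proof (rule eventually_eq_on_span[OF Hom_linear_into[OF tail_Hom[OF s(1,2) f], unfolded T]
        Hom_linear_into[OF tail_Hom[OF s(1,2) g], unfolded T] _ x[unfolded T]])
    fix u assume "u \<in> {gtens M A m t | m t. m \<in> total_space M \<and> t \<in> total_space A}"
    then obtain m t where u: "u = gtens M A m t" and m: "m \<in> total_space M" and t: "t \<in> total_space A"
      by blast
    from rel[OF t] show "\<forall>\<^sub>F z in F. tail M A B (f z) u = tail M A B (g z) u"
      by eventually_elim (simp add: u tail_gtens[OF s(1,2) f m t] tail_gtens[OF s(1,2) g m t])
  qed
qed

lemma tail_comp: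
  assumes s: "subspaces X" "subspaces Y" "subspaces Y'" and f: "f \<in> Hom Y Y'" and g: "g \<in> Hom Y' Y''"
    and x: "x \<in> total_space (X \<otimes>\<^sub>g Y)"
  shows "tail X Y Y'' (g \<circ> f) x = tail X Y' Y'' g (tail X Y Y' f x)"
proof -
  note T = total_gtensor[OF s(1,2)]
  note gf = Hom_comp[OF f g]
  show ?thesis
  proof (rule linear_into_eq_on_span[OF Hom_linear_into[OF tail_Hom[OF s(1,2) gf], unfolded T]
        linear_into_comp[OF Hom_linear_into[OF tail_Hom[OF s(1,2) f]] Hom_linear_into[OF tail_Hom[OF s(1,3) g]], unfolded T]
        _ x[unfolded T]])
    show "tail X Y Y'' (g \<circ> f) u = tail X Y' Y'' g (tail X Y Y' f u)"
      if "u \<in> {gtens X Y x y | x y. x \<in> total_space X \<and> y \<in> total_space Y}" for u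
      using that by (auto simp: tail_gtens[OF s(1,2) gf] tail_gtens[OF s(1,2) f] tail_gtens[OF s(1,3) g] Hom_mem[OF f])
  qed
qed

text \<open>The central computation. Commuting \<open>C12\<close> past \<open>D34\<close> factors the composite as \<open>id \<otimes> L\<close> after \<open>K\<close>,
  where \<open>K\<close> contains only \<open>C\<close> and \<open>L\<close> only \<open>D\<close>. The two given relations then apply in turn, the
  second one at the vector \<open>K x\<close>, which does not depend on \<open>z\<close>.\<close>

lemma composite_relation:
  assumes s: "subspaces X" "subspaces Y" "subspaces Z" "subspaces M" "subspaces N"
    and C: "C \<in> Hom (X \<otimes>\<^sub>g M) (M \<otimes>\<^sub>g Y)" and D: "D \<in> Hom (Y \<otimes>\<^sub>g N) (N \<otimes>\<^sub>g Z)"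
    and R: "\<And>z. R z \<in> Hom (X \<otimes>\<^sub>g X) (X \<otimes>\<^sub>g X)" and S: "\<And>z. S z \<in> Hom (Y \<otimes>\<^sub>g Y) (Y \<otimes>\<^sub>g Y)"
    and U: "\<And>z. U z \<in> Hom (Z \<otimes>\<^sub>g Z) (Z \<otimes>\<^sub>g Z)"
    and relC: "\<And>t. t \<in> total_space (X \<otimes>\<^sub>g (X \<otimes>\<^sub>g M)) \<Longrightarrow> \<forall>\<^sub>F z in F.
      head X M M Y Y C (tail X (X \<otimes>\<^sub>g M) (M \<otimes>\<^sub>g Y) C (head X X X X M (R z) t)) =
      tail M (Y \<otimes>\<^sub>g Y) (Y \<otimes>\<^sub>g Y) (S z) (head X M M Y Y C (tail X (X \<otimes>\<^sub>g M) (M \<otimes>\<^sub>g Y) C t))"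
    and relD: "\<And>t. t \<in> total_space (Y \<otimes>\<^sub>g (Y \<otimes>\<^sub>g N)) \<Longrightarrow> \<forall>\<^sub>F z in F.
      head Y N N Z Z D (tail Y (Y \<otimes>\<^sub>g N) (N \<otimes>\<^sub>g Z) D (head Y Y Y Y N (S z) t)) =
      tail N (Z \<otimes>\<^sub>g Z) (Z \<otimes>\<^sub>g Z) (U z) (head Y N N Z Z D (tail Y (Y \<otimes>\<^sub>g N) (N \<otimes>\<^sub>g Z) D t))"
    and x: "x \<in> total_space (X \<otimes>\<^sub>g (X \<otimes>\<^sub>g (M \<otimes>\<^sub>g N)))"
  defines "C23 \<equiv> tail X (X \<otimes>\<^sub>g (M \<otimes>\<^sub>g N)) (M \<otimes>\<^sub>g (Y \<otimes>\<^sub>g N)) (head X M M Y N C)"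
    and "D34 \<equiv> tail X (M \<otimes>\<^sub>g (Y \<otimes>\<^sub>g N)) (M \<otimes>\<^sub>g (N \<otimes>\<^sub>g Z)) (tail M (Y \<otimes>\<^sub>g N) (N \<otimes>\<^sub>g Z) D)"
    and "C12 \<equiv> head X M M Y (N \<otimes>\<^sub>g Z) C"
    and "D23 \<equiv> tail M (Y \<otimes>\<^sub>g (N \<otimes>\<^sub>g Z)) (N \<otimes>\<^sub>g (Z \<otimes>\<^sub>g Z)) (head Y N N Z Z D)"
  shows "\<forall>\<^sub>F z in F. D23 (C12 (D34 (C23 (head X X X X (M \<otimes>\<^sub>g N) (R z) x)))) =
    tail M (N \<otimes>\<^sub>g (Z \<otimes>\<^sub>g Z)) (N \<otimes>\<^sub>g (Z \<otimes>\<^sub>g Z)) (tail N (Z \<otimes>\<^sub>g Z) (Z \<otimes>\<^sub>g Z) (U z)) (D23 (C12 (D34 (C23 x))))"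
proof -
  note Hr = Hom_comp tail_Hom head_Hom subspaces_gtensor s C D R S U
  let ?YYN = "Y \<otimes>\<^sub>g (Y \<otimes>\<^sub>g N)" and ?NZZ = "N \<otimes>\<^sub>g (Z \<otimes>\<^sub>g Z)"
  define K where "K = head X M M Y (Y \<otimes>\<^sub>g N) C \<circ> C23"
  define L where "L = head Y N N Z Z D \<circ> tail Y (Y \<otimes>\<^sub>g N) (N \<otimes>\<^sub>g Z) D"
  have C23: "C23 \<in> Hom (X \<otimes>\<^sub>g (X \<otimes>\<^sub>g (M \<otimes>\<^sub>g N))) (X \<otimes>\<^sub>g (M \<otimes>\<^sub>g (Y \<otimes>\<^sub>g N)))"
    unfolding C23_def by (rule Hr)+
  have K: "K \<in> Hom (X \<otimes>\<^sub>g (X \<otimes>\<^sub>g (M \<otimes>\<^sub>g N))) (M \<otimes>\<^sub>g ?YYN)"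
    unfolding K_def by (rule Hr C23)+
  have tD: "tail Y (Y \<otimes>\<^sub>g N) (N \<otimes>\<^sub>g Z) D \<in> Hom ?YYN (Y \<otimes>\<^sub>g (N \<otimes>\<^sub>g Z))"
    and hD: "head Y N N Z Z D \<in> Hom (Y \<otimes>\<^sub>g (N \<otimes>\<^sub>g Z)) ?NZZ"
    and tC: "head X M M Y (Y \<otimes>\<^sub>g N) C \<in> Hom (X \<otimes>\<^sub>g (M \<otimes>\<^sub>g (Y \<otimes>\<^sub>g N))) (M \<otimes>\<^sub>g ?YYN)"
    by (rule Hr)+
  have L: "L \<in> Hom ?YYN ?NZZ"
    unfolding L_def by (rule Hr)+
  have S12: "head Y Y Y Y N (S z) \<in> Hom ?YYN ?YYN" and U23: "tail N (Z \<otimes>\<^sub>g Z) (Z \<otimes>\<^sub>g Z) (U z) \<in> Hom ?NZZ ?NZZ"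
    and R12: "head X X X X (M \<otimes>\<^sub>g N) (R z) \<in> Hom (X \<otimes>\<^sub>g (X \<otimes>\<^sub>g (M \<otimes>\<^sub>g N))) (X \<otimes>\<^sub>g (X \<otimes>\<^sub>g (M \<otimes>\<^sub>g N)))" for z
    by (rule Hr)+
  have sYN: "subspaces ?YYN" "subspaces ?NZZ" by (rule subspaces_gtensor)+
  have split: "D23 (C12 (D34 (C23 y))) = tail M ?YYN ?NZZ L (K y)"
    if y: "y \<in> total_space (X \<otimes>\<^sub>g (X \<otimes>\<^sub>g (M \<otimes>\<^sub>g N)))" for y
  proof -
    have y': "C23 y \<in> total_space (X \<otimes>\<^sub>g (M \<otimes>\<^sub>g (Y \<otimes>\<^sub>g N)))"
      by (rule Hom_mem[OF C23 y])
    have "C12 (D34 (C23 y)) = tail M ?YYN (Y \<otimes>\<^sub>g (N \<otimes>\<^sub>g Z)) (tail Y (Y \<otimes>\<^sub>g N) (N \<otimes>\<^sub>g Z) D) (K y)"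
      unfolding C12_def D34_def K_def o_apply
      by (rule head_tail_commute[OF s(1,4,4,2) subspaces_gtensor subspaces_gtensor C D y'])
    then show ?thesis
      unfolding D23_def L_def using tail_comp[OF s(4) sYN(1) subspaces_gtensor tD hD Hom_mem[OF K y]] by simp
  qed
  have "\<forall>\<^sub>F z in F. K (head X X X X (M \<otimes>\<^sub>g N) (R z) x) = tail M ?YYN ?YYN (head Y Y Y Y N (S z)) (K x)"
    using relation_tensor_spectator_right[OF s(1,2,4,5) C R S relC x] unfolding K_def C23_def .
  moreover have "\<forall>\<^sub>F z in F. tail M ?YYN ?NZZ (L \<circ> head Y Y Y Y N (S z)) (K x) =
      tail M ?YYN ?NZZ (tail N (Z \<otimes>\<^sub>g Z) (Z \<otimes>\<^sub>g Z) (U z) \<circ> L) (K x)"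
    by (rule relation_tensor_spectator_left[OF s(4) sYN Hom_comp[OF S12 L] Hom_comp[OF L U23] _ Hom_mem[OF K x]])
      (use relD in \<open>simp add: L_def\<close>)
  ultimately show ?thesis
  proof eventually_elim
    case (elim z)
    then show ?case
      by (simp add: split x Hom_mem[OF R12 x] tail_comp[OF s(4) sYN(1,1) S12 L Hom_mem[OF K x]]
          tail_comp[OF s(4) sYN(1,2) L U23 Hom_mem[OF K x]])
  qed
qed


section \<open>Rebracketing the composite\<close>

text \<open>Two ways to attach a factor \<open>w\<close> to \<open>e \<in> M \<otimes> (N \<otimes> Z)\<close>: with \<open>M \<otimes> N\<close> treated as one factor, or
  with all factors separate. They agree after rebracketing, again by the pentagon
  identity in the form \<open>snoc2_snoc\<close>.\<close>

lemma assoc_r_snoc: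
  assumes s: "subspaces M" "subspaces N" "subspaces Z" "subspaces W"
    and e: "e \<in> total_space (M \<otimes>\<^sub>g (N \<otimes>\<^sub>g Z))" and w: "w \<in> total_space W"
  shows "assoc_r M N (Z \<otimes>\<^sub>g W) (snoc (M \<otimes>\<^sub>g N) Z W (assoc_l M N Z e) w) = snoc2 M N Z W e w"
proof -
  note T = total_snoc[OF s(1-3)]
  have 1: "linear_into (total_space (M \<otimes>\<^sub>g (N \<otimes>\<^sub>g Z))) (total_space (M \<otimes>\<^sub>g (N \<otimes>\<^sub>g (Z \<otimes>\<^sub>g W))))
      (\<lambda>e. assoc_r M N (Z \<otimes>\<^sub>g W) (snoc (M \<otimes>\<^sub>g N) Z W (assoc_l M N Z e) w))"
    by (rule linear_into_comp[OF linear_into_comp[OF Hom_linear_into[OF assoc_l_Hom[OF s(1-3)]]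
            linear_into_snoc_left[OF subspaces_gtensor s(3,4) w]] Hom_linear_into[OF assoc_r_Hom[OF s(1,2) subspaces_gtensor]]])
  show ?thesis
  proof (rule linear_into_eq_on_span[OF 1[unfolded T] linear_into_snoc2[OF s w, unfolded T] _ e[unfolded T]])
    fix u assume "u \<in> {snoc M N Z p z | p z. p \<in> total_space (M \<otimes>\<^sub>g N) \<and> z \<in> total_space Z}"
    then obtain p z where u: "u = snoc M N Z p z" and p: "p \<in> total_space (M \<otimes>\<^sub>g N)" and z: "z \<in> total_space Z"
      by blast
    have "assoc_l M N Z u = gtens (M \<otimes>\<^sub>g N) Z p z"
      unfolding u snoc_def by (rule assoc_l_assoc_r[OF s(1-3) gtens_in_total[OF p z]])
    then have "assoc_r M N (Z \<otimes>\<^sub>g W) (snoc (M \<otimes>\<^sub>g N) Z W (assoc_l M N Z u) w) = snoc M N (Z \<otimes>\<^sub>g W) p (gtens Z W z w)"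
      by (simp add: snoc_gtens[OF subspaces_gtensor s(3,4) p z w] snoc_def[of M N])
    also have "\<dots> = snoc2 M N Z W u w"
      unfolding u by (rule snoc2_snoc[OF s p z w, symmetric])
    finally show "assoc_r M N (Z \<otimes>\<^sub>g W) (snoc (M \<otimes>\<^sub>g N) Z W (assoc_l M N Z u) w) = snoc2 M N Z W u w" .
  qed
qed

text \<open>Naturality of the associator in its last argument.\<close>

lemma assoc_r_tail:
  assumes s: "subspaces M" "subspaces N" "subspaces A" "subspaces B" and g: "g \<in> Hom A B"
    and t: "t \<in> total_space ((M \<otimes>\<^sub>g N) \<otimes>\<^sub>g A)"
  shows "assoc_r M N B (tail (M \<otimes>\<^sub>g N) A B g t) = tail M (N \<otimes>\<^sub>g A) (N \<otimes>\<^sub>g B) (tail N A B g) (assoc_r M N A t)"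
proof -
  note T = total_gtensor[OF subspaces_gtensor s(3)]
  have tg: "tail (M \<otimes>\<^sub>g N) A B g \<in> Hom ((M \<otimes>\<^sub>g N) \<otimes>\<^sub>g A) ((M \<otimes>\<^sub>g N) \<otimes>\<^sub>g B)"
    by (rule tail_Hom[OF subspaces_gtensor s(3) g])
  have 1: "assoc_r M N B \<circ> tail (M \<otimes>\<^sub>g N) A B g \<in> Hom ((M \<otimes>\<^sub>g N) \<otimes>\<^sub>g A) (M \<otimes>\<^sub>g (N \<otimes>\<^sub>g B))"
    by (rule Hom_comp[OF tg assoc_r_Hom[OF s(1,2,4)]])
  have 2: "tail M (N \<otimes>\<^sub>g A) (N \<otimes>\<^sub>g B) (tail N A B g) \<circ> assoc_r M N A \<in> Hom ((M \<otimes>\<^sub>g N) \<otimes>\<^sub>g A) (M \<otimes>\<^sub>g (N \<otimes>\<^sub>g B))"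
    by (rule Hom_comp[OF assoc_r_Hom[OF s(1-3)] tail_Hom[OF s(1) subspaces_gtensor tail_Hom[OF s(2,3) g]]])
  have "(assoc_r M N B \<circ> tail (M \<otimes>\<^sub>g N) A B g) t = (tail M (N \<otimes>\<^sub>g A) (N \<otimes>\<^sub>g B) (tail N A B g) \<circ> assoc_r M N A) t"
  proof (rule linear_into_eq_on_span[OF Hom_linear_into[OF 1, unfolded T] Hom_linear_into[OF 2, unfolded T] _ t[unfolded T]])
    fix u assume "u \<in> {gtens (M \<otimes>\<^sub>g N) A p a | p a. p \<in> total_space (M \<otimes>\<^sub>g N) \<and> a \<in> total_space A}"
    then obtain p a where u: "u = gtens (M \<otimes>\<^sub>g N) A p a" and p: "p \<in> total_space (M \<otimes>\<^sub>g N)" and a: "a \<in> total_space A"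
      by blast
    show "(assoc_r M N B \<circ> tail (M \<otimes>\<^sub>g N) A B g) u = (tail M (N \<otimes>\<^sub>g A) (N \<otimes>\<^sub>g B) (tail N A B g) \<circ> assoc_r M N A) u"
      using tail_tail_snoc[OF s g p a]
      by (simp add: u tail_gtens[OF subspaces_gtensor s(3) g p a] snoc_def)
  qed
  then show ?thesis by simp
qed

text \<open>The rebracketing inside \<open>E\<close> is undone in two places. That of the inner \<open>E\<close> becomes the argument
  \<open>tail assoc_l\<close> of the outer one, and is cancelled by \<open>tail assoc_r\<close>; that of the outer \<open>E\<close> is
  absorbed into the associator on the left hand side by \<open>assoc_r_snoc\<close>. What is left is
  tested on \<open>snoc p w\<close>, where both sides become \<open>snoc2\<close> of the composite at \<open>p\<close>.\<close>

lemma rebracketed_composite: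
  assumes s: "subspaces X" "subspaces Y" "subspaces Z" "subspaces M" "subspaces N"
    and C: "C \<in> Hom (X \<otimes>\<^sub>g M) (M \<otimes>\<^sub>g Y)" and D: "D \<in> Hom (Y \<otimes>\<^sub>g N) (N \<otimes>\<^sub>g Z)"
    and x: "x \<in> total_space (X \<otimes>\<^sub>g (X \<otimes>\<^sub>g (M \<otimes>\<^sub>g N)))"
  defines "E \<equiv> assoc_l M N Z \<circ> (tail M (Y \<otimes>\<^sub>g N) (N \<otimes>\<^sub>g Z) D \<circ> head X M M Y N C)"
    and "C23 \<equiv> tail X (X \<otimes>\<^sub>g (M \<otimes>\<^sub>g N)) (M \<otimes>\<^sub>g (Y \<otimes>\<^sub>g N)) (head X M M Y N C)"
    and "D34 \<equiv> tail X (M \<otimes>\<^sub>g (Y \<otimes>\<^sub>g N)) (M \<otimes>\<^sub>g (N \<otimes>\<^sub>g Z)) (tail M (Y \<otimes>\<^sub>g N) (N \<otimes>\<^sub>g Z) D)"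
    and "C12 \<equiv> head X M M Y (N \<otimes>\<^sub>g Z) C"
    and "D23 \<equiv> tail M (Y \<otimes>\<^sub>g (N \<otimes>\<^sub>g Z)) (N \<otimes>\<^sub>g (Z \<otimes>\<^sub>g Z)) (head Y N N Z Z D)"
  shows "assoc_r M N (Z \<otimes>\<^sub>g Z) (head X (M \<otimes>\<^sub>g N) (M \<otimes>\<^sub>g N) Z Z E
      (tail X (X \<otimes>\<^sub>g (M \<otimes>\<^sub>g N)) ((M \<otimes>\<^sub>g N) \<otimes>\<^sub>g Z) E x)) = D23 (C12 (D34 (C23 x)))"
proof -
  note Hr = Hom_comp tail_Hom head_Hom assoc_l_Hom assoc_r_Hom subspaces_gtensor s C D
  let ?MN = "M \<otimes>\<^sub>g N"
  let ?E12 = "head X ?MN ?MN Z Z E"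
  have hC: "head X M M Y N C \<in> Hom (X \<otimes>\<^sub>g (M \<otimes>\<^sub>g N)) (M \<otimes>\<^sub>g (Y \<otimes>\<^sub>g N))"
    and tD: "tail M (Y \<otimes>\<^sub>g N) (N \<otimes>\<^sub>g Z) D \<in> Hom (M \<otimes>\<^sub>g (Y \<otimes>\<^sub>g N)) (M \<otimes>\<^sub>g (N \<otimes>\<^sub>g Z))"
    and al: "assoc_l M N Z \<in> Hom (M \<otimes>\<^sub>g (N \<otimes>\<^sub>g Z)) (?MN \<otimes>\<^sub>g Z)"
    and ar: "assoc_r M N Z \<in> Hom (?MN \<otimes>\<^sub>g Z) (M \<otimes>\<^sub>g (N \<otimes>\<^sub>g Z))"
    and hD: "head Y N N Z Z D \<in> Hom (Y \<otimes>\<^sub>g (N \<otimes>\<^sub>g Z)) (N \<otimes>\<^sub>g (Z \<otimes>\<^sub>g Z))"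
    by (rule Hr)+
  have E: "E \<in> Hom (X \<otimes>\<^sub>g ?MN) (?MN \<otimes>\<^sub>g Z)"
    unfolding E_def by (rule Hr)+
  have C23: "C23 \<in> Hom (X \<otimes>\<^sub>g (X \<otimes>\<^sub>g ?MN)) (X \<otimes>\<^sub>g (M \<otimes>\<^sub>g (Y \<otimes>\<^sub>g N)))"
    and D34: "D34 \<in> Hom (X \<otimes>\<^sub>g (M \<otimes>\<^sub>g (Y \<otimes>\<^sub>g N))) (X \<otimes>\<^sub>g (M \<otimes>\<^sub>g (N \<otimes>\<^sub>g Z)))"
    unfolding C23_def D34_def by (rule Hr)+
  have l: "assoc_r M N (Z \<otimes>\<^sub>g Z) \<circ> ?E12 \<in> Hom (X \<otimes>\<^sub>g (?MN \<otimes>\<^sub>g Z)) (M \<otimes>\<^sub>g (N \<otimes>\<^sub>g (Z \<otimes>\<^sub>g Z)))"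
    by (rule Hr E)+
  have r: "D23 \<circ> (C12 \<circ> tail X (?MN \<otimes>\<^sub>g Z) (M \<otimes>\<^sub>g (N \<otimes>\<^sub>g Z)) (assoc_r M N Z))
      \<in> Hom (X \<otimes>\<^sub>g (?MN \<otimes>\<^sub>g Z)) (M \<otimes>\<^sub>g (N \<otimes>\<^sub>g (Z \<otimes>\<^sub>g Z)))"
    unfolding D23_def C12_def by (rule Hr)+
  note T = total_snoc[OF s(1) subspaces_gtensor s(3), of M N]
  \<comment> \<open>the identity for the outer factor \<open>E\<close>, with the inner rebracketing moved to the right hand side\<close>
  have *: "(assoc_r M N (Z \<otimes>\<^sub>g Z) \<circ> ?E12) y =
      (D23 \<circ> (C12 \<circ> tail X (?MN \<otimes>\<^sub>g Z) (M \<otimes>\<^sub>g (N \<otimes>\<^sub>g Z)) (assoc_r M N Z))) y"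
    if y: "y \<in> total_space (X \<otimes>\<^sub>g (?MN \<otimes>\<^sub>g Z))" for y
  proof (rule linear_into_eq_on_span[OF Hom_linear_into[OF l, unfolded T] Hom_linear_into[OF r, unfolded T] _ y[unfolded T]])
    fix u assume "u \<in> {snoc X ?MN Z p w | p w. p \<in> total_space (X \<otimes>\<^sub>g ?MN) \<and> w \<in> total_space Z}"
    then obtain p w where u: "u = snoc X ?MN Z p w" and p: "p \<in> total_space (X \<otimes>\<^sub>g ?MN)" and w: "w \<in> total_space Z"
      by blast
    have Cp: "head X M M Y N C p \<in> total_space (M \<otimes>\<^sub>g (Y \<otimes>\<^sub>g N))"
      by (rule Hom_mem[OF hC p])
    have "(D23 \<circ> (C12 \<circ> tail X (?MN \<otimes>\<^sub>g Z) (M \<otimes>\<^sub>g (N \<otimes>\<^sub>g Z)) (assoc_r M N Z))) u = D23 (C12 (snoc2 X M N Z p w))"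
      by (simp add: u snoc2_def)
    also have "\<dots> = snoc2 M N Z Z (tail M (Y \<otimes>\<^sub>g N) (N \<otimes>\<^sub>g Z) D (head X M M Y N C p)) w"
      by (simp add: C12_def D23_def head_snoc2[OF s(1,4,4,2,5,3) C p w] tail_head_snoc2[OF s(4,2,5,5,3,3) D Cp w])
    also have "\<dots> = assoc_r M N (Z \<otimes>\<^sub>g Z) (snoc ?MN Z Z (E p) w)"
      unfolding E_def using assoc_r_snoc[OF s(4,5,3,3) Hom_mem[OF tD Cp] w] by simp
    also have "\<dots> = (assoc_r M N (Z \<otimes>\<^sub>g Z) \<circ> ?E12) u"
      by (simp add: u head_snoc[OF s(1) subspaces_gtensor s(3) E p w])
    finally show "(assoc_r M N (Z \<otimes>\<^sub>g Z) \<circ> ?E12) u =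
        (D23 \<circ> (C12 \<circ> tail X (?MN \<otimes>\<^sub>g Z) (M \<otimes>\<^sub>g (N \<otimes>\<^sub>g Z)) (assoc_r M N Z))) u" ..
  qed
  have x': "D34 (C23 x) \<in> total_space (X \<otimes>\<^sub>g (M \<otimes>\<^sub>g (N \<otimes>\<^sub>g Z)))"
    by (rule Hom_mem[OF D34 Hom_mem[OF C23 x]])
  have Ex: "tail X (X \<otimes>\<^sub>g ?MN) (?MN \<otimes>\<^sub>g Z) E x = tail X (M \<otimes>\<^sub>g (N \<otimes>\<^sub>g Z)) (?MN \<otimes>\<^sub>g Z) (assoc_l M N Z) (D34 (C23 x))"
    unfolding E_def D34_def C23_def
    using tail_comp[OF s(1) subspaces_gtensor subspaces_gtensor Hom_comp[OF hC tD] al x]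
      tail_comp[OF s(1) subspaces_gtensor subspaces_gtensor hC tD x] by simp
  have cancel: "tail X (?MN \<otimes>\<^sub>g Z) (M \<otimes>\<^sub>g (N \<otimes>\<^sub>g Z)) (assoc_r M N Z)
      (tail X (M \<otimes>\<^sub>g (N \<otimes>\<^sub>g Z)) (?MN \<otimes>\<^sub>g Z) (assoc_l M N Z) y) = y"
    if y: "y \<in> total_space (X \<otimes>\<^sub>g (M \<otimes>\<^sub>g (N \<otimes>\<^sub>g Z)))" for y
  proof -
    note T = total_gtensor[OF s(1) subspaces_gtensor, of M "N \<otimes>\<^sub>g Z"]
    have "tail X (?MN \<otimes>\<^sub>g Z) (M \<otimes>\<^sub>g (N \<otimes>\<^sub>g Z)) (assoc_r M N Z)
      (tail X (M \<otimes>\<^sub>g (N \<otimes>\<^sub>g Z)) (?MN \<otimes>\<^sub>g Z) (assoc_l M N Z) y) = id y"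
    proof (rule linear_into_eq_on_span[OF linear_into_comp[OF Hom_linear_into[OF tail_Hom[OF s(1) subspaces_gtensor al]]
            Hom_linear_into[OF tail_Hom[OF s(1) subspaces_gtensor ar]], unfolded T] Hom_linear_into[OF id_Hom, where X = "X \<otimes>\<^sub>g (M \<otimes>\<^sub>g (N \<otimes>\<^sub>g Z))", unfolded T] _ y[unfolded T]])
      show "tail X (?MN \<otimes>\<^sub>g Z) (M \<otimes>\<^sub>g (N \<otimes>\<^sub>g Z)) (assoc_r M N Z)
          (tail X (M \<otimes>\<^sub>g (N \<otimes>\<^sub>g Z)) (?MN \<otimes>\<^sub>g Z) (assoc_l M N Z) u) = id u"
        if "u \<in> {gtens X (M \<otimes>\<^sub>g (N \<otimes>\<^sub>g Z)) v t | v t. v \<in> total_space X \<and> t \<in> total_space (M \<otimes>\<^sub>g (N \<otimes>\<^sub>g Z))}" for u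
        using that by (auto simp: tail_gtens[OF s(1) subspaces_gtensor al] tail_gtens[OF s(1) subspaces_gtensor ar]
            Hom_mem[OF al] assoc_r_assoc_l[OF s(4,5,3)])
    qed
    then show ?thesis by simp
  qed
  have "tail X (M \<otimes>\<^sub>g (N \<otimes>\<^sub>g Z)) (?MN \<otimes>\<^sub>g Z) (assoc_l M N Z) (D34 (C23 x)) \<in> total_space (X \<otimes>\<^sub>g (?MN \<otimes>\<^sub>g Z))"
    by (rule Hom_mem[OF tail_Hom[OF s(1) subspaces_gtensor al] x'])
  from *[OF this] show ?thesis
    by (simp add: Ex cancel[OF x'])
qed


section \<open>The composite graded space\<close>

lemma connecting_set_comp_arrows:
  assumes P: "connecting_set G H P" and Q: "connecting_set H K Q"
  shows "connecting_set G K (comp_arrows P Q)"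
proof -
  have "\<exists>j\<in>arr Q. tgt P i = src Q j" if "i \<in> arr P" for i
    using that P Q unfolding connecting_set_def by (metis imageE imageI)
  moreover have "\<exists>i\<in>arr P. tgt P i = src Q j" if "j \<in> arr Q" for j
    using that P Q unfolding connecting_set_def by (metis imageE imageI)
  ultimately have "src (comp_arrows P Q) ` arr (comp_arrows P Q) = src P ` arr P"
    "tgt (comp_arrows P Q) ` arr (comp_arrows P Q) = tgt Q ` arr Q"
    by (force simp: comp_arrows_def image_def)+
  then show ?thesis
    using P Q by (simp add: connecting_set_def)
qed

lemma span_tens_span:
  "cvec.span {tens v w | v w. v \<in> cvec.span A \<and> w \<in> cvec.span B} = cvec.span {tens v w | v w. v \<in> A \<and> w \<in> B}"
    (is "cvec.span ?L = cvec.span ?R")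
proof
  have 1: "tens v w \<in> cvec.span ?R" if "v \<in> A" "w \<in> cvec.span B" for v w
    using that(2) by (induction rule: cvec.span_induct_alt)
      (use that(1) in \<open>auto simp: tens_simps cvec.span_zero intro!: cvec.span_add cvec.span_scale intro: cvec.span_base\<close>)
  have "tens v w \<in> cvec.span ?R" if "v \<in> cvec.span A" "w \<in> cvec.span B" for v w
    using that(1) by (induction rule: cvec.span_induct_alt)
      (use 1 that(2) in \<open>auto simp: tens_simps cvec.span_zero intro!: cvec.span_add cvec.span_scale\<close>)
  then show "cvec.span ?L \<subseteq> cvec.span ?R"
    by (intro cvec.span_minimal) auto
  show "cvec.span ?R \<subseteq> cvec.span ?L"
    by (rule cvec.span_mono) (blast intro: cvec.span_base)
qed

text \<open>A nonzero component at \<open>(i, j)\<close> forces \<open>V i\<close> and \<open>W j\<close> to be nonzero. With a given source, there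
  are finitely many such \<open>i\<close>, and for each of them finitely many \<open>j\<close> that start at the target
  of \<open>i\<close>; the count for a given target is symmetric.\<close>

lemma finite_type_comp_arrows:
  assumes P: "finite_type P V" and Q: "finite_type Q W"
  shows "finite_type (comp_arrows P Q) (tensor_fib V W)"
proof -
  have nz: "V i \<noteq> {0} \<and> W j \<noteq> {0}" if "tensor_fib V W (i, j) \<noteq> {0}" for i j
  proof (rule ccontr)
    assume "\<not> (V i \<noteq> {0} \<and> W j \<noteq> {0})"
    then have "V i = {0} \<or> W j = {0}" by blast
    then have "tens v w = 0" if "v \<in> V i" "w \<in> W j" for v w
      using that tens_simps(5)[of w] tens_simps(6)[of v] by force
    then have "{tens v w | v w. v \<in> V i \<and> w \<in> W j} \<subseteq> {0}" by blast
    then have "cvec.span {tens v w | v w. v \<in> V i \<and> w \<in> W j} \<subseteq> cvec.span {0}"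
      by (rule cvec.span_mono)
    then have "tensor_fib V W (i, j) \<subseteq> cvec.span {0}"
      by (simp only: tensor_fib_def prod.case)
    moreover have "0 \<in> tensor_fib V W (i, j)"
      by (simp add: tensor_fib_def cvec.span_zero)
    ultimately show False using that by auto
  qed
  have fin: "\<exists>B. finite B \<and> tensor_fib V W k = cvec.span B" if "k \<in> arr (comp_arrows P Q)" for k
  proof -
    obtain i j where k: "k = (i, j)" "i \<in> arr P" "j \<in> arr Q"
      using \<open>k \<in> _\<close> by (auto simp: comp_arrows_def)
    obtain A B where "finite A" "V i = cvec.span A" "finite B" "W j = cvec.span B"
      using P Q k unfolding finite_type_def by meson
    moreover have "finite {tens v w | v w. v \<in> A \<and> w \<in> B}" if "finite A" "finite B"
      using that by (rule finite_image_set2[of "\<lambda>v. v \<in> A" "\<lambda>w. w \<in> B", simplified])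
    ultimately show ?thesis
      unfolding k(1) tensor_fib_def by (auto simp: span_tens_span)
  qed
  define FP where "FP = (\<lambda>a. {i \<in> arr P. src P i = a \<and> V i \<noteq> {0}})"
  define FQ where "FQ = (\<lambda>b. {j \<in> arr Q. src Q j = b \<and> W j \<noteq> {0}})"
  define TP where "TP = (\<lambda>a. {i \<in> arr P. tgt P i = a \<and> V i \<noteq> {0}})"
  define TQ where "TQ = (\<lambda>b. {j \<in> arr Q. tgt Q j = b \<and> W j \<noteq> {0}})"
  have f: "finite (FP a)" "finite (FQ b)" "finite (TP b)" "finite (TQ c)" for a b c
    using P Q by (simp_all add: finite_type_def FP_def FQ_def TP_def TQ_def)
  have "finite {k \<in> arr (comp_arrows P Q). src (comp_arrows P Q) k = a \<and> tensor_fib V W k \<noteq> {0}}" for a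
    by (rule finite_subset[of _ "SIGMA i:FP a. FQ (tgt P i)"])
      (use nz f in \<open>auto simp: comp_arrows_def FP_def FQ_def\<close>)
  moreover have "finite {k \<in> arr (comp_arrows P Q). tgt (comp_arrows P Q) k = c \<and> tensor_fib V W k \<noteq> {0}}" for c
    by (rule finite_subset[of _ "prod.swap ` (SIGMA j:TQ c. TP (src Q j))"])
      (use nz f in \<open>force simp: comp_arrows_def TP_def TQ_def\<close>)+
  ultimately show ?thesis
    using fin by (simp add: finite_type_def)
qed

lemma gr_comp_arrows: "gr (comp_arrows P Q) (tensor_fib V W) = gr P V \<otimes>\<^sub>g gr Q W"
  by (simp add: gtensor_def gr_def comp_arrows_def)

theorem proposition3p9:
  fixes G1 :: "('a1, 'o1) groupoid" and G2 :: "('a2, 'o2) groupoid" and G3 :: "('a3, 'o3) groupoid"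
    and V1 :: "'a1 \<Rightarrow> 'v1::complex_vector set" and V2 :: "'a2 \<Rightarrow> 'v2::complex_vector set"
    and V3 :: "'a3 \<Rightarrow> 'v3::complex_vector set"
    and P :: "('p, 'o1, 'o2) arrows" and V :: "'p \<Rightarrow> 'v::complex_vector set"
    and Q :: "('q, 'o2, 'o3) arrows" and W :: "'q \<Rightarrow> 'w::complex_vector set"
    and C :: "('a1 \<times> 'p \<Rightarrow>\<^sub>0 ('v1, 'v) tensor) \<Rightarrow> ('p \<times> 'a2 \<Rightarrow>\<^sub>0 ('v, 'v2) tensor)"
    and D :: "('a2 \<times> 'q \<Rightarrow>\<^sub>0 ('v2, 'w) tensor) \<Rightarrow> ('q \<times> 'a3 \<Rightarrow>\<^sub>0 ('w, 'v3) tensor)"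
  assumes "is_groupoid G1" "is_groupoid G2" "is_groupoid G3"
    and "finite_type G1 V1" "finite_type G2 V2" "finite_type G3 V3"
    and "yang_baxter G1 V1 R1" "yang_baxter G2 V2 R2" "yang_baxter G3 V3 R3"
    and "connecting_set G1 G2 P" "finite_type P V"
    and "connecting_set G2 G3 Q" "finite_type Q W"
    and "intertwiner G1 V1 R1 G2 V2 R2 P V C"
    and "intertwiner G2 V2 R2 G3 V3 R3 Q W D"
  shows "let X1 = gr G1 V1; X2 = gr G2 V2; X3 = gr G3 V3; M = gr P V; N = gr Q W;
             E = tail M (X2 \<otimes>\<^sub>g N) (N \<otimes>\<^sub>g X3) D \<circ> head X1 M M X2 N C;
             R12 = (\<lambda>z. head X1 X1 X1 X1 (M \<otimes>\<^sub>g N) (R1 z));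
             C23 = tail X1 (X1 \<otimes>\<^sub>g M \<otimes>\<^sub>g N) (M \<otimes>\<^sub>g X2 \<otimes>\<^sub>g N) (head X1 M M X2 N C);
             D34 = tail X1 (M \<otimes>\<^sub>g X2 \<otimes>\<^sub>g N) (M \<otimes>\<^sub>g N \<otimes>\<^sub>g X3) (tail M (X2 \<otimes>\<^sub>g N) (N \<otimes>\<^sub>g X3) D);
             C12 = head X1 M M X2 (N \<otimes>\<^sub>g X3) C;
             D23 = tail M (X2 \<otimes>\<^sub>g N \<otimes>\<^sub>g X3) (N \<otimes>\<^sub>g X3 \<otimes>\<^sub>g X3) (head X2 N N X3 X3 D);
             R34 = (\<lambda>z. tail M (N \<otimes>\<^sub>g X3 \<otimes>\<^sub>g X3) (N \<otimes>\<^sub>g X3 \<otimes>\<^sub>g X3)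
                          (tail N (X3 \<otimes>\<^sub>g X3) (X3 \<otimes>\<^sub>g X3) (R3 z)))
         in connecting_set G1 G3 (comp_arrows P Q) \<and>
            finite_type (comp_arrows P Q) (tensor_fib V W) \<and>
            E \<in> Hom (X1 \<otimes>\<^sub>g M \<otimes>\<^sub>g N) (M \<otimes>\<^sub>g N \<otimes>\<^sub>g X3) \<and>
            intertwiner G1 V1 R1 G3 V3 R3 (comp_arrows P Q) (tensor_fib V W) (assoc_l M N X3 \<circ> E) \<and>
            (\<forall>x\<in>total_space (X1 \<otimes>\<^sub>g X1 \<otimes>\<^sub>g M \<otimes>\<^sub>g N). \<forall>\<^sub>\<approx>z.
               D23 (C12 (D34 (C23 (R12 z x)))) = R34 z (D23 (C12 (D34 (C23 x)))))"
proof -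
  define X1 X2 X3 M N where "X1 = gr G1 V1" and "X2 = gr G2 V2" and "X3 = gr G3 V3"
    and "M = gr P V" and "N = gr Q W"
  note XMN = X1_def X2_def X3_def M_def N_def
  have s: "subspaces X1" "subspaces X2" "subspaces X3" "subspaces M" "subspaces N"
    unfolding XMN using assms(4-6,11,13) by (auto intro: finite_type_subspaces)
  have R: "R1 z \<in> Hom (X1 \<otimes>\<^sub>g X1) (X1 \<otimes>\<^sub>g X1)" "R2 z \<in> Hom (X2 \<otimes>\<^sub>g X2) (X2 \<otimes>\<^sub>g X2)"
    "R3 z \<in> Hom (X3 \<otimes>\<^sub>g X3) (X3 \<otimes>\<^sub>g X3)" for z
    unfolding XMN using assms(1-9) by (auto intro!: End2_Hom simp: yang_baxter_def Let_def)
  have C: "C \<in> Hom (X1 \<otimes>\<^sub>g M) (M \<otimes>\<^sub>g X2)"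
    and relC: "\<And>t. t \<in> total_space (X1 \<otimes>\<^sub>g (X1 \<otimes>\<^sub>g M)) \<Longrightarrow> \<forall>\<^sub>\<approx>z.
      head X1 M M X2 X2 C (tail X1 (X1 \<otimes>\<^sub>g M) (M \<otimes>\<^sub>g X2) C (head X1 X1 X1 X1 M (R1 z) t)) =
      tail M (X2 \<otimes>\<^sub>g X2) (X2 \<otimes>\<^sub>g X2) (R2 z) (head X1 M M X2 X2 C (tail X1 (X1 \<otimes>\<^sub>g M) (M \<otimes>\<^sub>g X2) C t))"
    using assms(14) unfolding intertwiner_def Let_def XMN by blast+
  have D: "D \<in> Hom (X2 \<otimes>\<^sub>g N) (N \<otimes>\<^sub>g X3)"
    and relD: "\<And>t. t \<in> total_space (X2 \<otimes>\<^sub>g (X2 \<otimes>\<^sub>g N)) \<Longrightarrow> \<forall>\<^sub>\<approx>z.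
      head X2 N N X3 X3 D (tail X2 (X2 \<otimes>\<^sub>g N) (N \<otimes>\<^sub>g X3) D (head X2 X2 X2 X2 N (R2 z) t)) =
      tail N (X3 \<otimes>\<^sub>g X3) (X3 \<otimes>\<^sub>g X3) (R3 z) (head X2 N N X3 X3 D (tail X2 (X2 \<otimes>\<^sub>g N) (N \<otimes>\<^sub>g X3) D t))"
    using assms(15) unfolding intertwiner_def Let_def XMN by blast+
  note Hr = Hom_comp tail_Hom head_Hom assoc_l_Hom assoc_r_Hom subspaces_gtensor s C D R
  let ?MN = "M \<otimes>\<^sub>g N"
  define E where "E = tail M (X2 \<otimes>\<^sub>g N) (N \<otimes>\<^sub>g X3) D \<circ> head X1 M M X2 N C"
  have E: "E \<in> Hom (X1 \<otimes>\<^sub>g ?MN) (M \<otimes>\<^sub>g (N \<otimes>\<^sub>g X3))"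
    unfolding E_def by (rule Hr)+
  let ?E = "assoc_l M N X3 \<circ> E"
  have E': "?E \<in> Hom (X1 \<otimes>\<^sub>g ?MN) (?MN \<otimes>\<^sub>g X3)"
    by (rule Hr E)+
  let ?K = "\<lambda>x. tail M (X2 \<otimes>\<^sub>g (N \<otimes>\<^sub>g X3)) (N \<otimes>\<^sub>g (X3 \<otimes>\<^sub>g X3)) (head X2 N N X3 X3 D)
    (head X1 M M X2 (N \<otimes>\<^sub>g X3) C
      (tail X1 (M \<otimes>\<^sub>g (X2 \<otimes>\<^sub>g N)) (M \<otimes>\<^sub>g (N \<otimes>\<^sub>g X3)) (tail M (X2 \<otimes>\<^sub>g N) (N \<otimes>\<^sub>g X3) D)
        (tail X1 (X1 \<otimes>\<^sub>g ?MN) (M \<otimes>\<^sub>g (X2 \<otimes>\<^sub>g N)) (head X1 M M X2 N C) x)))"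
  let ?L = "\<lambda>x. head X1 ?MN ?MN X3 X3 ?E (tail X1 (X1 \<otimes>\<^sub>g ?MN) (?MN \<otimes>\<^sub>g X3) ?E x)"
  let ?A = "assoc_r M N (X3 \<otimes>\<^sub>g X3)"
  have rel: "\<forall>\<^sub>\<approx>z. ?K (head X1 X1 X1 X1 ?MN (R1 z) x) =
      tail M (N \<otimes>\<^sub>g (X3 \<otimes>\<^sub>g X3)) (N \<otimes>\<^sub>g (X3 \<otimes>\<^sub>g X3)) (tail N (X3 \<otimes>\<^sub>g X3) (X3 \<otimes>\<^sub>g X3) (R3 z)) (?K x)"
    if "x \<in> total_space (X1 \<otimes>\<^sub>g (X1 \<otimes>\<^sub>g ?MN))" for x
    by (rule composite_relation[OF s C D R relC relD that])
  have KL: "?A (?L x) = ?K x" if "x \<in> total_space (X1 \<otimes>\<^sub>g (X1 \<otimes>\<^sub>g ?MN))" for x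
    unfolding E_def by (rule rebracketed_composite[OF s C D that])
  have L: "(head X1 ?MN ?MN X3 X3 ?E \<circ> tail X1 (X1 \<otimes>\<^sub>g ?MN) (?MN \<otimes>\<^sub>g X3) ?E)
      \<in> Hom (X1 \<otimes>\<^sub>g (X1 \<otimes>\<^sub>g ?MN)) (?MN \<otimes>\<^sub>g (X3 \<otimes>\<^sub>g X3))"
    by (rule E' tail_Hom head_Hom subspaces_gtensor s Hom_comp)+
  have R12: "head X1 X1 X1 X1 ?MN (R1 z) \<in> Hom (X1 \<otimes>\<^sub>g (X1 \<otimes>\<^sub>g ?MN)) (X1 \<otimes>\<^sub>g (X1 \<otimes>\<^sub>g ?MN))"
    and S23: "tail ?MN (X3 \<otimes>\<^sub>g X3) (X3 \<otimes>\<^sub>g X3) (R3 z) \<in> Hom (?MN \<otimes>\<^sub>g (X3 \<otimes>\<^sub>g X3)) (?MN \<otimes>\<^sub>g (X3 \<otimes>\<^sub>g X3))" for z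
    by (rule Hr)+
  have relL: "\<forall>\<^sub>\<approx>z. ?L (head X1 X1 X1 X1 ?MN (R1 z) x) = tail ?MN (X3 \<otimes>\<^sub>g X3) (X3 \<otimes>\<^sub>g X3) (R3 z) (?L x)"
    if x: "x \<in> total_space (X1 \<otimes>\<^sub>g (X1 \<otimes>\<^sub>g ?MN))" for x
    using rel[OF x]
  proof eventually_elim
    case (elim z)
    have Lt: "?L y \<in> total_space (?MN \<otimes>\<^sub>g (X3 \<otimes>\<^sub>g X3))" if "y \<in> total_space (X1 \<otimes>\<^sub>g (X1 \<otimes>\<^sub>g ?MN))" for y
      using Hom_mem[OF L that] by simp
    have "?A (?L (head X1 X1 X1 X1 ?MN (R1 z) x)) = ?A (tail ?MN (X3 \<otimes>\<^sub>g X3) (X3 \<otimes>\<^sub>g X3) (R3 z) (?L x))"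
      using elim KL[OF x] KL[OF Hom_mem[OF R12 x]]
        assoc_r_tail[OF s(4,5) subspaces_gtensor subspaces_gtensor R(3) Lt[OF x]] by simp
    \<comment> \<open>\<open>?A\<close> is injective, so it can be cancelled\<close>
    then show ?case
      using assoc_l_assoc_r[OF s(4,5) subspaces_gtensor] Lt[OF Hom_mem[OF R12 x]] Hom_mem[OF S23 Lt[OF x]]
      by metis
  qed
  have "intertwiner G1 V1 R1 G3 V3 R3 (comp_arrows P Q) (tensor_fib V W) ?E"
    unfolding intertwiner_def Let_def gr_comp_arrows
    using E' relL unfolding XMN by blast
  moreover have "connecting_set G1 G3 (comp_arrows P Q)"
    by (rule connecting_set_comp_arrows[OF assms(10,12)])
  moreover have "finite_type (comp_arrows P Q) (tensor_fib V W)"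
    by (rule finite_type_comp_arrows[OF assms(11,13)])
  ultimately show ?thesis
    using E rel unfolding Let_def E_def XMN by blast
qed

end
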